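(* Let $p,q\ge 0$ be fixed real numbers with $p+q\le 1$, and let $G_n(p,q)$ be a random signed graph on $n$ vertices with (signed) adjacency matrix $A(G_n(p,q))$. Then almost every random signed graph $G_n(p,q)$ satisfies $$\mathcal{E}(A(G_n(p,q)))=n^{3/2}\left(\frac{8}{3\pi}\sqrt{p+q-(p-q)^2}+o(1)\right),$$ where $o(1)$ denotes a quantity tending to $0$ as $n\to\infty$.
   Context: A signed graph is a simple graph in which each edge is labeled positive or negative. Its adjacency matrix is the symmetric matrix with $(i,j)$ entry $+1$ if $v_iv_j$ is a positive edge, $-1$ if $v_iv_j$ is a negative edge, and $0$ otherwise (in particular, the diagonal is zero). The energy $\mathcal{E}(M)$ of a real symmetric matrix $M$ is the sum of the absolute values of its eigenvalues, counted with multiplicity. Random signed graph $G_n(p,q)$: on a set of $n$ vertices, between each pair of distinct vertices there is a positive edge with probability $p$, a negative edge with probability $q$, and no edge with probability $1-(p+q)$, independently for different pairs of vertices. "Almost every" / "almost surely" means "with probability tending to $1$ as $n\to\infty$". Thus the assertion means: for every $\varepsilon>0$, the probability that $\left|n^{-3/2}\mathcal{E}(A(G_n(p,q)))-\frac{8}{3\pi}\sqrt{p+q-(p-q)^2}\right|<\varepsilon$ tends to $1$ as $n\to\infty$. *)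

theory Defs
  imports
    "HOL-Probability.Probability"
    "Jordan_Normal_Form.Spectral_Radius"
begin

datatype sign = Positive | Negative

text \<open>
  A signed graph is a partial map sending each edge, as a two-element set of vertices, to its
  sign; its domain is the edge set of the underlying simple graph.  The vertex set is not part of
  the map, so it is passed separately.
\<close>
type_synonym signed_graph = "nat set \<Rightarrow> sign option"

definition vertex_pairs :: "nat \<Rightarrow> nat set set" where
  "vertex_pairs n = {e. e \<subseteq> {..<n} \<and> card e = 2}"

definition is_signed_graph :: "nat \<Rightarrow> signed_graph \<Rightarrow> bool" where
  "is_signed_graph n G \<longleftrightarrow> dom G \<subseteq> vertex_pairs n"

text \<open>On the diagonal \<open>{i, j}\<close> is the singleton \<open>{i}\<close>, which is never an edge of a signed graph.\<close>
definition signed_adjacency :: "nat \<Rightarrow> signed_graph \<Rightarrow> real mat" where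
  "signed_adjacency n G = mat n n (\<lambda>(i, j).
     case G {i, j} of Some Positive \<Rightarrow> 1 | Some Negative \<Rightarrow> -1 | None \<Rightarrow> 0)"

text \<open>
  Intended for symmetric \<open>M\<close>, all of whose eigenvalues are real; the order of an eigenvalue as a
  root of the characteristic polynomial is its multiplicity.
\<close>
definition energy :: "real mat \<Rightarrow> real" where
  "energy M = (\<Sum>x\<in>spectrum M. real (Polynomial.order x (char_poly M)) * \<bar>x\<bar>)"

definition edge_pmf :: "real \<Rightarrow> real \<Rightarrow> sign option pmf" where
  "edge_pmf p q =
     pmf_of_list [(Some Positive, p), (Some Negative, q), (None, 1 - (p + q))]"

text \<open>\<open>Pi_pmf\<close> makes the pairs independent and leaves every set outside \<open>vertex_pairs n\<close> a non-edge.\<close>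
definition random_signed_graph :: "nat \<Rightarrow> real \<Rightarrow> real \<Rightarrow> signed_graph pmf" where
  "random_signed_graph n p q = Pi_pmf (vertex_pairs n) None (\<lambda>_. edge_pmf p q)"

lemma finite_vertex_pairs: "finite (vertex_pairs n)"
  by (rule finite_subset[of _ "Pow {..<n}"]) (auto simp: vertex_pairs_def)

lemma pmf_edge_pmf:
  assumes "0 \<le> p" "0 \<le> q" "p + q \<le> 1"
  shows "pmf (edge_pmf p q) (Some Positive) = p"
    and "pmf (edge_pmf p q) (Some Negative) = q"
    and "pmf (edge_pmf p q) None = 1 - (p + q)"
proof -
  have "pmf_of_list_wf [(Some Positive, p), (Some Negative, q), (None, 1 - (p + q))]"
    using assms by (auto simp: pmf_of_list_wf_def)
  then show "pmf (edge_pmf p q) (Some Positive) = p"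
    and "pmf (edge_pmf p q) (Some Negative) = q"
    and "pmf (edge_pmf p q) None = 1 - (p + q)"
    by (simp_all add: edge_pmf_def pmf_pmf_of_list)
qed

lemma is_signed_graph_random_signed_graph:
  assumes "G \<in> set_pmf (random_signed_graph n p q)"
  shows "is_signed_graph n G"
proof -
  have "G e = None" if "e \<notin> vertex_pairs n" for e
    using assms that set_Pi_pmf_subset[OF finite_vertex_pairs, of n None "\<lambda>_. edge_pmf p q"]
    unfolding random_signed_graph_def by blast
  then show ?thesis
    unfolding is_signed_graph_def by (force simp: dom_def)
qed

lemma symmetric_signed_adjacency:
  "transpose_mat (signed_adjacency n G) = signed_adjacency n G"
  by (auto simp: signed_adjacency_def insert_commute)

lemma signed_adjacency_diagonal:
  assumes "is_signed_graph n G" "i < n"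
  shows "signed_adjacency n G $$ (i, i) = 0"
proof -
  have "G {i} = None"
    using assms(1) by (auto simp: is_signed_graph_def vertex_pairs_def dom_def)
  then show ?thesis
    using assms(2) by (simp add: signed_adjacency_def)
qed

end

theory Submission
  imports Defs "HOL-Real_Asymp.Real_Asymp"
begin

text \<open>
  The proof uses resolvents. For \<open>R = (A - i t n\<^sup>1\<^sup>/\<^sup>2)\<^sup>-\<^sup>1\<close> with trace \<open>S\<close>, put \<open>z = S / n\<^sup>1\<^sup>/\<^sup>2\<close>,
  \<open>s = p + q - (p - q)\<^sup>2\<close> and \<open>Q = 1 + i t z + s z\<^sup>2\<close>. Since \<open>n (1 + i t z)\<close> is the trace of \<open>A R\<close>,
  resampling one edge at a time and expanding \<open>R\<close> to first order in that edge gives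
  \<open>E \<bar>Q\<bar>\<^sup>2 = E (cnj Q * Q) \<longlonglongrightarrow> 0\<close>; neither centring nor a separate concentration argument is needed, because
  the mean only contributes the sum of all entries of \<open>R\<close>, which is at most \<open>n\<^sup>1\<^sup>/\<^sup>2 / t\<close>. The equation
  \<open>Q = 0\<close> is stable, so \<open>Im z\<close> approaches the semicircle value. Finally
  \<open>\<bar>x\<bar> = (2 / \<pi>) \<integral>\<^sub>0\<^sup>\<infinity> x\<^sup>2 / (x\<^sup>2 + t\<^sup>2) dt\<close> expresses the energy through \<open>Im z\<close>, and dominated convergence applies
  because the sum of the squared eigenvalues is at most \<open>n\<^sup>2\<close>.
\<close>

section \<open>Diagonalisation of real symmetric matrices\<close>

text \<open>The number \<open>s\<close> is the variance of an off-diagonal entry of A: second moment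
  p + q minus squared mean. \<open>Q = 0\<close> is the quadratic equation of the Stieltjes
  transform, at the point i t, of the semicircle law with variance \<open>s\<close>. The imaginary
  axis suffices because the integral for |x| involves only Im z, so no spectral measure has to be
  shown to converge. In E (cnj Q * Q) only the factor Q is expanded into entries of A and R; cnj Q
  stays inside the function f that multiplies an entry x. If x takes the values 1, -1, 0 with mean m
  and f is nearly affine in x, then E ((x - m) f) is close to \<open>s\<close> times the slope of f.
  This is where the term s z^2 comes from, and it produces one cancellation per edge. With \<tau> =
  t n^(1/2) and t fixed, the error per edge is O(n^(-3/2)); n E |Q|^2 collects about n^2 of these
  and a remainder O(n^(1/2)), so E |Q|^2 = O(n^(-1/2)). The constant 8 / (3 \<pi>) is the 2 / \<pi>
  of the integral for |x| times the 4 / 3 of the semicircle integral.\<close>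

no_notation inner (infix "\<bullet>" 70)

text \<open>A complex eigenvector x + i y exists because the characteristic polynomial splits over
  the complex numbers. Evaluating (A x) . y = x . (A y) on the real and imaginary parts leaves Im m
  * (|x|^2 + |y|^2) = 0, so m is real and whichever of x, y is nonzero is a real
  eigenvector.\<close>

lemma real_symmetric_unit_eigenvector:
  fixes A :: "real mat"
  assumes A: "A \<in> carrier_mat n n" and sym: "transpose_mat A = A" and n: "n > 0"
  obtains v e where "v \<in> carrier_vec n" "v \<bullet> v = 1" "A *\<^sub>v v = e \<cdot>\<^sub>v v"
proof -
  let ?C = "map_mat complex_of_real A"
  have C: "?C \<in> carrier_mat n n" using A by simp
  from char_poly_factorized[OF C] obtain as where
    as: "char_poly ?C = (\<Prod>a\<leftarrow>as. [:- a, 1:])" "length as = n" by blast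
  from n as(2) obtain m as' where as': "as = m # as'" by (cases as) auto
  have "poly (char_poly ?C) m = 0" unfolding as(1) as' by simp
  then obtain w where "eigenvector ?C w m"
    using eigenvalue_root_char_poly[OF C] by (auto simp: eigenvalue_def)
  then have w: "w \<in> carrier_vec n" "w \<noteq> 0\<^sub>v n" and ev: "?C *\<^sub>v w = m \<cdot>\<^sub>v w"
    using A by (auto simp: eigenvector_def)
  define x y where "x = map_vec Re w" and "y = map_vec Im w"
  have x: "x \<in> carrier_vec n" and y: "y \<in> carrier_vec n" using w by (auto simp: x_def y_def)
  have evi: "(\<Sum>k<n. complex_of_real (A $$ (i,k)) * w $ k) = m * w $ i" if "i < n" for i
    using arg_cong[OF ev, of "\<lambda>v. v $ i"] that A w
    by (simp add: scalar_prod_def lessThan_atLeast0)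
  have Ax: "A *\<^sub>v x = Re m \<cdot>\<^sub>v x - Im m \<cdot>\<^sub>v y"
  proof (rule eq_vecI)
    fix i assume "i < dim_vec (Re m \<cdot>\<^sub>v x - Im m \<cdot>\<^sub>v y)"
    then have i: "i < n" using y by simp
    show "(A *\<^sub>v x) $ i = (Re m \<cdot>\<^sub>v x - Im m \<cdot>\<^sub>v y) $ i"
      using arg_cong[OF evi[OF i], of Re] i A w
      by (simp add: scalar_prod_def x_def y_def lessThan_atLeast0)
  qed (use A x y in auto)
  have Ay: "A *\<^sub>v y = Im m \<cdot>\<^sub>v x + Re m \<cdot>\<^sub>v y"
  proof (rule eq_vecI)
    fix i assume "i < dim_vec (Im m \<cdot>\<^sub>v x + Re m \<cdot>\<^sub>v y)"
    then have i: "i < n" using y by simp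
    show "(A *\<^sub>v y) $ i = (Im m \<cdot>\<^sub>v x + Re m \<cdot>\<^sub>v y) $ i"
      using arg_cong[OF evi[OF i], of Im] i A w
      by (simp add: scalar_prod_def x_def y_def lessThan_atLeast0)
  qed (use A x y in auto)
  have "(A *\<^sub>v x) \<bullet> y = x \<bullet> (A *\<^sub>v y)"
    using transpose_vec_mult_scalar[OF A y x] sym by simp
  then have "(Re m \<cdot>\<^sub>v x - Im m \<cdot>\<^sub>v y) \<bullet> y = x \<bullet> (Im m \<cdot>\<^sub>v x + Re m \<cdot>\<^sub>v y)"
    by (simp add: Ax Ay)
  then have "Im m * (x \<bullet> x + y \<bullet> y) = 0"
    using x y by (simp add: minus_scalar_prod_distrib[of _ n] scalar_prod_add_distrib[of _ n] algebra_simps)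
  moreover have pos: "u \<bullet> u > 0" if "u \<in> carrier_vec n" "u \<noteq> 0\<^sub>v n" for u :: "real vec"
    using conjugate_square_greater_0_vec[OF that(1)] that(2) by simp
  have nz: "x \<noteq> 0\<^sub>v n \<or> y \<noteq> 0\<^sub>v n"
  proof (rule ccontr)
    assume "\<not> ?thesis"
    then have xy: "x = 0\<^sub>v n" "y = 0\<^sub>v n" by auto
    have "w $ i = 0" if "i < n" for i
    proof -
      have "x $ i = 0" "y $ i = 0" using xy that by auto
      then show ?thesis using that w by (simp add: x_def y_def complex_eq_iff)
    qed
    then show False using w by (auto intro: eq_vecI)
  qed
  have "x \<bullet> x + y \<bullet> y > 0"
  proof -
    have "u \<bullet> u \<ge> 0" for u :: "real vec" by (simp add: scalar_prod_def sum_nonneg)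
    then show ?thesis using nz pos x y by (metis add_pos_nonneg add_nonneg_pos)
  qed
  ultimately have im: "Im m = 0" by simp
  obtain u where u: "u \<in> carrier_vec n" "u \<noteq> 0\<^sub>v n" "A *\<^sub>v u = Re m \<cdot>\<^sub>v u"
  proof (cases "x = 0\<^sub>v n")
    case True
    have "A *\<^sub>v y = Re m \<cdot>\<^sub>v y" using x y by (auto simp: Ay im intro!: eq_vecI)
    with True nz y that show ?thesis by blast
  next
    case False
    have "A *\<^sub>v x = Re m \<cdot>\<^sub>v x" using x y by (auto simp: Ax im intro!: eq_vecI)
    with False x that show ?thesis by blast
  qed
  define v where "v = (1 / sqrt (u \<bullet> u)) \<cdot>\<^sub>v u"
  have "v \<bullet> v = 1" using u(1) pos[OF u(1,2)] by (simp add: v_def)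
  moreover have "A *\<^sub>v v = Re m \<cdot>\<^sub>v v"
    using u A by (auto simp: v_def mult_mat_vec[of _ n n] smult_smult_assoc mult.commute)
  ultimately show ?thesis using u(1) that[of v "Re m"] by (simp add: v_def)
qed

text \<open>The Householder reflection along \<open>v - e\<^sub>0\<close>; for \<open>v = e\<^sub>0\<close> the coefficient \<open>2 / 0 = 0\<close> makes it the identity.\<close>
lemma householder:
  fixes v :: "real vec"
  assumes v: "v \<in> carrier_vec (Suc m)" and vv: "v \<bullet> v = 1"
  obtains H where "H \<in> carrier_mat (Suc m) (Suc m)" "transpose_mat H = H" "H * H = 1\<^sub>m (Suc m)"
    "H *\<^sub>v unit_vec (Suc m) 0 = v"
proof -
  define w where "w i = v $ i - (if i = 0 then 1 else 0)" for i
  define W where "W = (\<Sum>i<Suc m. w i * w i)"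
  define c where "c = 2 / W"
  define H where "H = mat (Suc m) (Suc m) (\<lambda>(i,j). (if i = j then 1 else 0) - c * w i * w j)"
  have H: "H \<in> carrier_mat (Suc m) (Suc m)" by (simp add: H_def)
  have v1: "(\<Sum>i<Suc m. v $ i * v $ i) = 1"
    using v vv by (simp add: scalar_prod_def lessThan_atLeast0)
  have "W = (\<Sum>i<Suc m. v $ i * v $ i - (if i = 0 then 2 * v $ 0 - 1 else 0))"
    unfolding W_def by (intro sum.cong) (auto simp: w_def algebra_simps)
  also have "\<dots> = 2 - 2 * v $ 0"
    unfolding sum_subtractf v1 by (simp add: sum.delta)
  finally have W: "W = 2 - 2 * v $ 0" .
  have cW: "c * c * W = 2 * c" by (simp add: c_def)
  have sym: "transpose_mat H = H" by (auto simp: H_def)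
  moreover have "H * H = 1\<^sub>m (Suc m)"
  proof (rule eq_matI)
    fix i j assume "i < dim_row (1\<^sub>m (Suc m) :: real mat)" "j < dim_col (1\<^sub>m (Suc m) :: real mat)"
    then have i: "i < Suc m" and j: "j < Suc m" by auto
    have "(H * H) $$ (i,j) = (\<Sum>k<Suc m. ((if i = k then 1 else 0) - c * w i * w k) * ((if k = j then 1 else 0) - c * w k * w j))"
      using i j by (simp add: H_def scalar_prod_def lessThan_atLeast0)
    also have "\<dots> = (\<Sum>k<Suc m. (if k = i then (if i = j then 1 else 0) - c * w i * w j else 0)
        - (if k = j then c * w i * w j else 0) + c * c * w i * w j * (w k * w k))"
      by (intro sum.cong) (auto simp: algebra_simps)
    also have "\<dots> = (if i = j then 1 else 0) - c * w i * w j - c * w i * w j + c * c * w i * w j * W"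
      using i j unfolding sum.distrib sum_subtractf W_def sum_distrib_left[symmetric]
      by (simp add: sum.delta del: sum.lessThan_Suc)
    also have "\<dots> = (if i = j then 1 else 0) - 2 * c * w i * w j + (c * c * W) * w i * w j"
      by (simp add: algebra_simps)
    also have "\<dots> = 1\<^sub>m (Suc m) $$ (i,j)" using i j by (simp add: cW)
    finally show "(H * H) $$ (i,j) = 1\<^sub>m (Suc m) $$ (i,j)" .
  qed (auto simp: H_def)
  moreover have "H *\<^sub>v unit_vec (Suc m) 0 = v"
  proof (rule eq_vecI)
    fix i assume "i < dim_vec v"
    then have i: "i < Suc m" using v by simp
    have "(H *\<^sub>v unit_vec (Suc m) 0) $ i = H $$ (i,0)"
      using i H by simp
    also have "\<dots> = (if i = 0 then 1 else 0) - c * w i * w 0" using i by (simp add: H_def)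
    also have "\<dots> = v $ i"
    proof (cases "W = 0")
      case True
      then have "\<forall>i\<in>{..<Suc m}. w i * w i = 0" unfolding W_def by (subst (asm) sum_nonneg_eq_0_iff) auto
      with i have "w i = 0" by simp
      then show ?thesis by (simp add: w_def split: if_splits)
    next
      case False
      \<comment> \<open>\<open>W = 2 - 2 * v $ 0\<close> is the same as
        \<open>-2 * w 0\<close>.\<close>
      have "c * w 0 = -1" using False W by (simp add: c_def w_def field_simps)
      then have "c * w i * w 0 = - w i" by (metis mult.assoc mult.commute mult_minus1)
      then show ?thesis by (simp add: w_def)
    qed
    finally show "(H *\<^sub>v unit_vec (Suc m) 0) $ i = v $ i" .
  qed (use H v in auto)
  ultimately show ?thesis using H that by blast
qed

lemma sum_count_list:
  fixes f :: "'a \<Rightarrow> real"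
  shows "(\<Sum>x\<in>set xs. real (count_list xs x) * f x) = (\<Sum>x\<leftarrow>xs. f x)"
proof (induction xs)
  case (Cons y ys)
  have "(\<Sum>x\<in>set (y # ys). real (count_list (y # ys) x) * f x)
      = (\<Sum>x\<in>insert y (set ys). real (count_list ys x) * f x + (if x = y then f y else 0))"
    by (intro sum.cong) (auto simp: algebra_simps)
  also have "\<dots> = (\<Sum>x\<in>insert y (set ys). real (count_list ys x) * f x) + f y"
    by (simp add: sum.distrib sum.delta)
  also have "(\<Sum>x\<in>insert y (set ys). real (count_list ys x) * f x) = (\<Sum>x\<in>set ys. real (count_list ys x) * f x)"
    by (intro sum.mono_neutral_right) (auto simp: count_list_0_iff)
  finally show ?case using Cons by simp
qed simp

text \<open>Deflation: conjugating by a reflection that exchanges a unit eigenvector with the first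
  basis vector clears the first column off the diagonal, and by symmetry the first row, so the
  induction hypothesis applies to the remaining block. The reflection is its own transpose and
  inverse, which keeps the conjugation orthogonal.\<close>

theorem real_symmetric_diagonalisation:
  fixes A :: "real mat"
  assumes "A \<in> carrier_mat n n" "transpose_mat A = A"
  shows "\<exists>U D. U \<in> carrier_mat n n \<and> D \<in> carrier_mat n n \<and> diagonal_mat D \<and>
           U * transpose_mat U = 1\<^sub>m n \<and> A = U * D * transpose_mat U"
  using assms
proof (induction n arbitrary: A)
  case 0
  then show ?case
    by (intro exI[of _ "1\<^sub>m 0"] exI[of _ "0\<^sub>m 0 0"]) (auto simp: diagonal_mat_def)
next
  case (Suc m)
  note A = Suc.prems(1) and sym = Suc.prems(2)
  obtain v e where v: "v \<in> carrier_vec (Suc m)" "v \<bullet> v = 1" "A *\<^sub>v v = e \<cdot>\<^sub>v v"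
    by (rule real_symmetric_unit_eigenvector[OF A sym]) auto
  obtain H where H: "H \<in> carrier_mat (Suc m) (Suc m)" "transpose_mat H = H" "H * H = 1\<^sub>m (Suc m)"
    "H *\<^sub>v unit_vec (Suc m) 0 = v" by (rule householder[OF v(1,2)])
  define B where "B = H * A * H"
  have B: "B \<in> carrier_mat (Suc m) (Suc m)" using H A by (simp add: B_def)
  have Bsym: "transpose_mat B = B"
    using H A by (simp add: B_def transpose_mult[of _ "Suc m" "Suc m" _ "Suc m"] sym assoc_mult_mat[of _ "Suc m" "Suc m" _ "Suc m" _ "Suc m"])
  have Hv: "H *\<^sub>v v = unit_vec (Suc m) 0"
  proof -
    have "(H * H) *\<^sub>v unit_vec (Suc m) 0 = H *\<^sub>v v"
      using assoc_mult_mat_vec[OF H(1) H(1), of "unit_vec (Suc m) 0"] H(4) by simp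
    then show ?thesis unfolding H(3) by simp
  qed
  have Be0: "B *\<^sub>v unit_vec (Suc m) 0 = e \<cdot>\<^sub>v unit_vec (Suc m) 0"
    using H A v by (simp add: B_def assoc_mult_mat_vec[of _ "Suc m" "Suc m" _ "Suc m"] mult_mat_vec[of _ "Suc m" "Suc m"] Hv)
  have B0: "B $$ (i,0) = (if i = 0 then e else 0)" if "i < Suc m" for i
  proof -
    have "B $$ (i,0) = (B *\<^sub>v unit_vec (Suc m) 0) $ i" using that B by simp
    then show ?thesis using Be0 that by simp
  qed
  have B0': "B $$ (0,i) = (if i = 0 then e else 0)" if "i < Suc m" for i
    using B0[OF that] arg_cong[OF Bsym, of "\<lambda>M. M $$ (0,i)"] that B by simp
  define A' where "A' = mat m m (\<lambda>(i,j). B $$ (Suc i, Suc j))"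
  have A': "A' \<in> carrier_mat m m" by (simp add: A'_def)
  have "transpose_mat A' = A'"
  proof (rule eq_matI)
    fix i j assume "i < dim_row A'" "j < dim_col A'"
    then show "transpose_mat A' $$ (i,j) = A' $$ (i,j)"
      using arg_cong[OF Bsym, of "\<lambda>M. M $$ (Suc i,Suc j)"] B by (simp add: A'_def)
  qed (auto simp: A'_def)
  from Suc.IH[OF A' this] obtain U D where U: "U \<in> carrier_mat m m" and D: "D \<in> carrier_mat m m"
    and diag: "diagonal_mat D" and UU: "U * transpose_mat U = 1\<^sub>m m"
    and A'eq: "A' = U * D * transpose_mat U" by blast
  define V E where "V = four_block_mat (1\<^sub>m 1) (0\<^sub>m 1 m) (0\<^sub>m m 1) U"
    and "E = four_block_mat (mat 1 1 (\<lambda>_. e)) (0\<^sub>m 1 m) (0\<^sub>m m 1) D"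
  have Vt: "transpose_mat V = four_block_mat (1\<^sub>m 1) (0\<^sub>m 1 m) (0\<^sub>m m 1) (transpose_mat U)"
    unfolding V_def by (subst transpose_four_block_mat[of _ 1 1 _ m _ m]) (use U in auto)
  have V: "V \<in> carrier_mat (Suc m) (Suc m)" and E: "E \<in> carrier_mat (Suc m) (Suc m)"
    using U D four_block_carrier_mat[of "1\<^sub>m 1" 1 1 U m m] four_block_carrier_mat[of "mat 1 1 (\<lambda>_. e)" 1 1 D m m]
    by (auto simp: V_def E_def)
  have VV: "V * transpose_mat V = 1\<^sub>m (Suc m)"
    by (subst Vt, unfold V_def, subst mult_four_block_mat[of _ 1 1 _ m _ m _ _ 1 _ m])
      (use U UU four_block_one_mat[of 1 m] in auto)
  have VE: "V * E = four_block_mat (mat 1 1 (\<lambda>_. e)) (0\<^sub>m 1 m) (0\<^sub>m m 1) (U * D)"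
    by (unfold V_def E_def, subst mult_four_block_mat[of _ 1 1 _ m _ m _ _ 1 _ m]) (use U D in auto)
  have VEV: "V * E * transpose_mat V = four_block_mat (mat 1 1 (\<lambda>_. e)) (0\<^sub>m 1 m) (0\<^sub>m m 1) A'"
    unfolding A'eq by (subst VE, subst Vt, subst mult_four_block_mat[of _ 1 1 _ m _ m _ _ 1 _ m]) (use U D in auto)
  have Beq: "B = V * E * transpose_mat V"
    unfolding VEV
  proof (rule eq_matI)
    fix i j assume "i < dim_row (four_block_mat (mat 1 1 (\<lambda>_. e)) (0\<^sub>m 1 m) (0\<^sub>m m 1) A')"
      "j < dim_col (four_block_mat (mat 1 1 (\<lambda>_. e)) (0\<^sub>m 1 m) (0\<^sub>m m 1) A')"
    then have "i < Suc m" "j < Suc m" by (auto simp: A'_def)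
    then show "B $$ (i,j) = four_block_mat (mat 1 1 (\<lambda>_. e)) (0\<^sub>m 1 m) (0\<^sub>m m 1) A' $$ (i,j)"
      using B0 B0' by (cases i; cases j) (auto simp: A'_def)
  qed (use B in \<open>auto simp: A'_def\<close>)
  have Ediag: "diagonal_mat E"
    using diag D by (auto simp: diagonal_mat_def E_def)
  note assoc = assoc_mult_mat[of _ "Suc m" "Suc m" _ "Suc m" _ "Suc m"]
  have HV: "H * V \<in> carrier_mat (Suc m) (Suc m)" using H V by simp
  have HVt: "transpose_mat (H * V) = transpose_mat V * H"
    using H V by (simp add: transpose_mult[of _ "Suc m" "Suc m" _ "Suc m"])
  have "(H * V) * transpose_mat (H * V) = H * (V * transpose_mat V) * H"
    unfolding HVt using H V by (simp add: assoc)
  then have 1: "(H * V) * transpose_mat (H * V) = 1\<^sub>m (Suc m)" unfolding VV using H by simp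
  have "A = (H * H) * A * (H * H)" unfolding H(3) using A by simp
  also have "\<dots> = H * B * H" using H(1) A by (simp add: B_def assoc)
  also have "\<dots> = (H * V) * E * transpose_mat (H * V)"
    unfolding HVt Beq using H(1) V E by (simp add: assoc)
  finally show ?case using HV E Ediag 1 by blast
qed

section \<open>The energy as a sum over an orthonormal eigenbasis\<close>

lemma order_prod_linear_factors:
  "Polynomial.order x (\<Prod>a\<leftarrow>as. [:- a, 1:]) = count_list as (x :: real)"
proof (induction as)
  case (Cons a as)
  have nz: "(\<Prod>a\<leftarrow>bs. [:- a, 1:]) \<noteq> (0 :: real poly)" for bs
    by (auto simp: prod_list_zero_iff)
  have "Polynomial.order x [:- a, 1:] = (if a = x then 1 else 0)"
    using order_power_n_n[of a 1] by (cases "a = x") (auto intro: order_0I)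
  moreover have "Polynomial.order x ([:- a, 1:] * (\<Prod>a\<leftarrow>as. [:- a, 1:]))
      = Polynomial.order x [:- a, 1:] + Polynomial.order x (\<Prod>a\<leftarrow>as. [:- a, 1:])"
    by (rule order_mult) (use nz[of "a # as"] in \<open>simp only: list.map prod_list.Cons not_False_eq_True\<close>)
  ultimately show ?case unfolding list.map prod_list.Cons Cons.IH by simp
qed (simp add: order_0I)

text \<open>Similarity gives A the characteristic polynomial of its diagonal form, so root orders
  count repetitions on the diagonal and the energy becomes a sum over indices. The two orthogonality
  relations are U U^T = 1 and U^T U = 1; later arguments use only these sums.\<close>

lemma symmetric_spectral_representation:
  fixes A :: "real mat"
  assumes A: "A \<in> carrier_mat n n" and sym: "transpose_mat A = A"
  obtains lam :: "nat \<Rightarrow> real" and u :: "nat \<Rightarrow> nat \<Rightarrow> real" where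
    "\<And>i j. i < n \<Longrightarrow> j < n \<Longrightarrow> A $$ (i,j) = (\<Sum>k<n. lam k * u k i * u k j)"
    "\<And>i j. i < n \<Longrightarrow> j < n \<Longrightarrow> (\<Sum>k<n. u k i * u k j) = (if i = j then 1 else 0)"
    "\<And>k l. k < n \<Longrightarrow> l < n \<Longrightarrow> (\<Sum>i<n. u k i * u l i) = (if k = l then 1 else 0)"
    "energy A = (\<Sum>k<n. \<bar>lam k\<bar>)"
proof -
  from real_symmetric_diagonalisation[OF A sym] obtain U D where
    U: "U \<in> carrier_mat n n" and D: "D \<in> carrier_mat n n" and diag: "diagonal_mat D"
    and UU: "U * transpose_mat U = 1\<^sub>m n" and AU: "A = U * D * transpose_mat U" by blast
  have UU': "transpose_mat U * U = 1\<^sub>m n"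
    using mat_mult_left_right_inverse[OF U _ UU] U by simp
  define lam where "lam k = D $$ (k,k)" for k
  define u where "u k i = U $$ (i,k)" for k i
  have "similar_mat A D"
    unfolding similar_mat_def similar_mat_wit_def Let_def
    using A U D UU UU' AU by (intro exI[of _ U] exI[of _ "transpose_mat U"]) auto
  then have "char_poly A = char_poly D" by (rule char_poly_similar)
  also have "\<dots> = (\<Prod>a\<leftarrow>diag_mat D. [:- a, 1:])"
    using D diag by (intro char_poly_upper_triangular[of _ n]) (auto simp: diagonal_mat_def)
  finally have cp: "char_poly A = (\<Prod>a\<leftarrow>diag_mat D. [:- a, 1:])" .
  have spec: "spectrum A = set (diag_mat D)"
    unfolding spectrum_def eigenvalue_root_char_poly[OF A] cp
    by (auto simp: poly_prod_list prod_list_zero_iff)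
  have "energy A = (\<Sum>x\<in>set (diag_mat D). real (count_list (diag_mat D) x) * \<bar>x\<bar>)"
    unfolding energy_def spec cp order_prod_linear_factors ..
  also have "\<dots> = (\<Sum>x\<leftarrow>diag_mat D. \<bar>x\<bar>)"
    by (rule sum_count_list)
  also have "\<dots> = (\<Sum>k<n. \<bar>lam k\<bar>)"
    using D by (simp add: diag_mat_def lam_def interv_sum_list_conv_sum_set_nat o_def lessThan_atLeast0)
  finally have en: "energy A = (\<Sum>k<n. \<bar>lam k\<bar>)" .
  have Dij: "D $$ (k,l) = (if k = l then lam k else 0)" if "k < n" "l < n" for k l
    using diag D that by (auto simp: diagonal_mat_def lam_def)
  have 1: "A $$ (i,j) = (\<Sum>k<n. lam k * u k i * u k j)" if ij: "i < n" "j < n" for i j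
  proof -
    have UD: "(U * D) $$ (i,l) = U $$ (i,l) * lam l" if "l < n" for l
    proof -
      have "(U * D) $$ (i,l) = (\<Sum>k<n. U $$ (i,k) * (if k = l then lam k else 0))"
        using U D ij that by (simp add: scalar_prod_def lessThan_atLeast0 Dij)
      also have "\<dots> = (\<Sum>k<n. if k = l then U $$ (i,l) * lam l else 0)"
        by (intro sum.cong) auto
      finally show ?thesis using that by simp
    qed
    have "A $$ (i,j) = (\<Sum>l<n. (U * D) $$ (i,l) * U $$ (j,l))"
      unfolding AU using U D ij by (subst index_mult_mat) (auto simp: scalar_prod_def lessThan_atLeast0 intro!: sum.cong)
    then show ?thesis using UD by (simp add: u_def mult_ac)
  qed
  have 2: "(\<Sum>k<n. u k i * u k j) = (if i = j then 1 else 0)" if "i < n" "j < n" for i j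
    using arg_cong[OF UU, of "\<lambda>M. M $$ (i,j)"] that U
    by (simp add: scalar_prod_def u_def lessThan_atLeast0)
  have 3: "(\<Sum>i<n. u k i * u l i) = (if k = l then 1 else 0)" if "k < n" "l < n" for k l
    using arg_cong[OF UU', of "\<lambda>M. M $$ (k,l)"] that U
    by (simp add: scalar_prod_def u_def lessThan_atLeast0)
  show ?thesis using that[of lam u] 1 2 3 en by blast
qed

section \<open>Resolvents\<close>

definition spectral_rep :: "real mat \<Rightarrow> (nat \<Rightarrow> real) \<Rightarrow> (nat \<Rightarrow> nat \<Rightarrow> real) \<Rightarrow> bool" where
  "spectral_rep A lam u \<longleftrightarrow> (let n = dim_row A in
     (\<forall>i<n. \<forall>j<n. A $$ (i,j) = (\<Sum>k<n. lam k * u k i * u k j)) \<and>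
     (\<forall>i<n. \<forall>j<n. (\<Sum>k<n. u k i * u k j) = (if i = j then 1 else 0)) \<and>
     (\<forall>k<n. \<forall>l<n. (\<Sum>i<n. u k i * u l i) = (if k = l then 1 else 0)) \<and>
     energy A = (\<Sum>k<n. \<bar>lam k\<bar>))"

text \<open>Fixing one eigenbasis per matrix by choice turns eigenvalues and eigenvectors into
  functions of the matrix, which can then be composed with a random graph.\<close>

definition spectral_data :: "real mat \<Rightarrow> (nat \<Rightarrow> real) \<times> (nat \<Rightarrow> nat \<Rightarrow> real)" where
  "spectral_data A = (SOME (lam, u). spectral_rep A lam u)"

definition eigval :: "real mat \<Rightarrow> nat \<Rightarrow> real" where
  "eigval A = fst (spectral_data A)"

definition eigvec :: "real mat \<Rightarrow> nat \<Rightarrow> nat \<Rightarrow> real" where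
  "eigvec A = snd (spectral_data A)"

text \<open>The entries of (A - i \<tau>)^(-1) in the eigenbasis. Size estimates can be read off
  this form; that it is an inverse is recovered in \<open>resolvent_eq\<close>. No conjugates appear
  because the eigenvectors are real.\<close>

definition resolvent :: "real mat \<Rightarrow> real \<Rightarrow> nat \<Rightarrow> nat \<Rightarrow> complex" where
  "resolvent A \<tau> i j = (\<Sum>k<dim_row A. of_real (eigvec A k i) * of_real (eigvec A k j) / (of_real (eigval A k) - \<i> * of_real \<tau>))"

definition resolvent_trace :: "real mat \<Rightarrow> real \<Rightarrow> complex" where
  "resolvent_trace A \<tau> = (\<Sum>i<dim_row A. resolvent A \<tau> i i)"

lemma spectral_rep_exists:
  assumes A: "A \<in> carrier_mat n n" and sym: "transpose_mat A = A"
  shows "\<exists>lam u. spectral_rep A lam u"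
proof -
  have "dim_row A = n" using A by simp
  then show ?thesis
    unfolding spectral_rep_def Let_def
    by (rule_tac symmetric_spectral_representation[OF A sym]) blast
qed

text \<open>Brings a product of two eigenvector expansions into the form in which the inner sum over
  coordinates is an orthonormality relation.\<close>

lemma sum_mult_sum_swap:
  fixes f g :: "'a \<Rightarrow> 'c :: comm_semiring_0"
  shows "(\<Sum>j\<in>J. (\<Sum>k\<in>K. f k * x k j) * (\<Sum>l\<in>L. g l * y l j))
    = (\<Sum>k\<in>K. \<Sum>l\<in>L. f k * g l * (\<Sum>j\<in>J. x k j * y l j))"
proof -
  have "(\<Sum>j\<in>J. (\<Sum>k\<in>K. f k * x k j) * (\<Sum>l\<in>L. g l * y l j))
    = (\<Sum>j\<in>J. \<Sum>k\<in>K. \<Sum>l\<in>L. f k * g l * (x k j * y l j))"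
    unfolding sum_product by (intro sum.cong refl) (simp only: mult_ac)
  also have "\<dots> = (\<Sum>k\<in>K. \<Sum>j\<in>J. \<Sum>l\<in>L. f k * g l * (x k j * y l j))"
    by (rule sum.swap)
  also have "\<dots> = (\<Sum>k\<in>K. \<Sum>l\<in>L. \<Sum>j\<in>J. f k * g l * (x k j * y l j))"
    by (intro sum.cong refl, rule sum.swap)
  finally show ?thesis unfolding sum_distrib_left .
qed

locale symmetric_mat =
  fixes A :: "real mat" and n :: nat
  assumes carrier: "A \<in> carrier_mat n n" and sym: "transpose_mat A = A"
begin

lemma dim [simp]: "dim_row A = n" using carrier by simp

lemma spectral_rep: "spectral_rep A (eigval A) (eigvec A)"
proof -
  obtain lam u where "spectral_rep A lam u" using spectral_rep_exists[OF carrier sym] by blast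
  then have "case (lam, u) of (lam, u) \<Rightarrow> spectral_rep A lam u" by simp
  then have "case spectral_data A of (lam, u) \<Rightarrow> spectral_rep A lam u"
    unfolding spectral_data_def by (rule someI)
  then show ?thesis by (simp add: eigval_def eigvec_def case_prod_unfold)
qed

lemmas spectral_rep_conjuncts = spectral_rep[unfolded spectral_rep_def Let_def dim]

lemmas entry = spectral_rep_conjuncts[THEN conjunct1, rule_format]
  and eigvec_complete = spectral_rep_conjuncts[THEN conjunct2, THEN conjunct1, rule_format]
  and eigvec_orthonormal = spectral_rep_conjuncts[THEN conjunct2, THEN conjunct2, THEN conjunct1, rule_format]
  and energy_eq = spectral_rep_conjuncts[THEN conjunct2, THEN conjunct2, THEN conjunct2]

text \<open>The coefficients are complex, so that the identity covers rows of the resolvent as well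
  as rows of A.\<close>

lemma parseval:
  fixes c :: "nat \<Rightarrow> complex"
  shows "(\<Sum>j<n. (cmod (\<Sum>k<n. c k * of_real (eigvec A k j)))\<^sup>2) = (\<Sum>k<n. (cmod (c k))\<^sup>2)"
proof -
  have "of_real (\<Sum>j<n. (cmod (\<Sum>k<n. c k * of_real (eigvec A k j)))\<^sup>2)
      = (\<Sum>j<n. (\<Sum>k<n. c k * of_real (eigvec A k j)) * cnj (\<Sum>l<n. c l * of_real (eigvec A l j)))"
    by (simp only: of_real_sum complex_norm_square)
  also have "\<dots> = (\<Sum>j<n. (\<Sum>k<n. c k * of_real (eigvec A k j)) * (\<Sum>l<n. cnj (c l) * of_real (eigvec A l j)))"
    by (simp only: cnj_sum complex_cnj_mult complex_cnj_complex_of_real)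
  also have "\<dots> = (\<Sum>k<n. \<Sum>l<n. c k * cnj (c l) * of_real (\<Sum>j<n. eigvec A k j * eigvec A l j))"
    unfolding sum_mult_sum_swap by (simp only: of_real_sum of_real_mult)
  also have "\<dots> = (\<Sum>k<n. \<Sum>l<n. if k = l then c k * cnj (c k) else 0)"
    by (intro sum.cong refl) (auto simp: eigvec_orthonormal)
  also have "\<dots> = of_real (\<Sum>k<n. (cmod (c k))\<^sup>2)"
    by (simp only: of_real_sum complex_norm_square) simp
  finally show ?thesis by (simp only: of_real_eq_iff)
qed

text \<open>Parseval on each row of A, whose coefficients are \<lambda>_k u_k(i), followed by
  summation over i. It is the source of the 1 / t^2 decay that dominates the energy
  integrand.\<close>

lemma sum_eigval_squares: "(\<Sum>k<n. (eigval A k)\<^sup>2) = (\<Sum>i<n. \<Sum>j<n. (A $$ (i,j))\<^sup>2)"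
proof -
  have "(\<Sum>j<n. (A $$ (i,j))\<^sup>2) = (\<Sum>k<n. (eigval A k)\<^sup>2 * (eigvec A k i * eigvec A k i))" if i: "i < n" for i
  proof -
    have "(A $$ (i,j))\<^sup>2 = (cmod (\<Sum>k<n. of_real (eigval A k * eigvec A k i) * of_real (eigvec A k j)))\<^sup>2" if "j < n" for j
    proof -
      have "(\<Sum>k<n. of_real (eigval A k * eigvec A k i) * of_real (eigvec A k j)) = complex_of_real (A $$ (i,j))"
        by (simp only: entry[OF i that] of_real_sum of_real_mult)
      then show ?thesis by (simp only: norm_of_real power2_abs)
    qed
    then have "(\<Sum>j<n. (A $$ (i,j))\<^sup>2) = (\<Sum>k<n. (cmod (of_real (eigval A k * eigvec A k i)))\<^sup>2)"
      unfolding parseval[of "\<lambda>k. of_real (eigval A k * eigvec A k i)", symmetric] by simp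
    also have "\<dots> = (\<Sum>k<n. (eigval A k)\<^sup>2 * (eigvec A k i * eigvec A k i))"
      by (simp only: norm_of_real power2_abs power_mult_distrib power2_eq_square[of "eigvec _ _ _"])
    finally show ?thesis .
  qed
  then have "(\<Sum>i<n. \<Sum>j<n. (A $$ (i,j))\<^sup>2) = (\<Sum>i<n. \<Sum>k<n. (eigval A k)\<^sup>2 * (eigvec A k i * eigvec A k i))"
    by simp
  also have "\<dots> = (\<Sum>k<n. (eigval A k)\<^sup>2 * (\<Sum>i<n. eigvec A k i * eigvec A k i))"
    by (subst sum.swap) (simp add: sum_distrib_left)
  also have "\<dots> = (\<Sum>k<n. (eigval A k)\<^sup>2)" by (simp add: eigvec_orthonormal)
  finally show ?thesis ..
qed

lemma resolvent_commute: "resolvent A \<tau> i j = resolvent A \<tau> j i"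
  by (simp add: resolvent_def mult_ac)

context
  fixes \<tau> :: real
  assumes \<tau>: "\<tau> > 0"
begin

lemma denominator_nonzero: "of_real x - \<i> * of_real \<tau> \<noteq> 0"
  using \<tau> by (auto simp: complex_eq_iff)

lemma cmod_denominator: "(cmod (of_real x - \<i> * of_real \<tau>))\<^sup>2 = x\<^sup>2 + \<tau>\<^sup>2"
  by (simp add: cmod_power2)

lemma cmod_denominator_ge: "cmod (of_real x - \<i> * of_real \<tau>) \<ge> \<tau>"
  by (rule power2_le_imp_le) (auto simp: cmod_denominator)

text \<open>This is (A - i \<tau>) R = 1 in coordinates. On each eigenvector it is the identity
  \<lambda> / (\<lambda> - i \<tau>) = 1 + i \<tau> / (\<lambda> - i \<tau>).\<close>

lemma resolvent_eq:
  assumes i: "i < n" and j: "j < n"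
  shows "(\<Sum>k<n. of_real (A $$ (i,k)) * resolvent A \<tau> k j) = (if i = j then 1 else 0) + \<i> * of_real \<tau> * resolvent A \<tau> i j"
proof -
  let ?d = "\<lambda>k. of_real (eigval A k) - \<i> * complex_of_real \<tau>"
  let ?v = "\<lambda>k i. complex_of_real (eigvec A k i)"
  have "(\<Sum>k<n. of_real (A $$ (i,k)) * resolvent A \<tau> k j)
     = (\<Sum>k<n. (\<Sum>l<n. of_real (eigval A l) * ?v l i * ?v l k) * (\<Sum>m<n. ?v m k * ?v m j / ?d m))"
    using i by (intro sum.cong refl) (simp add: entry resolvent_def)
  also have "\<dots> = (\<Sum>k<n. (\<Sum>l<n. (of_real (eigval A l) * ?v l i) * ?v l k) * (\<Sum>m<n. (?v m j / ?d m) * ?v m k))"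
    by (intro sum.cong refl arg_cong2[of _ _ _ _ times]) (simp only: times_divide_eq_left times_divide_eq_right mult.commute)
  also have "\<dots> = (\<Sum>l<n. \<Sum>m<n. (of_real (eigval A l) * ?v l i) * (?v m j / ?d m) * of_real (\<Sum>k<n. eigvec A l k * eigvec A m k))"
    unfolding sum_mult_sum_swap by (simp only: of_real_sum of_real_mult)
  also have "\<dots> = (\<Sum>l<n. \<Sum>m<n. if m = l then of_real (eigval A l) * ?v l i * ?v l j / ?d l else 0)"
    by (intro sum.cong refl) (auto simp: eigvec_orthonormal)
  also have "\<dots> = (\<Sum>l<n. of_real (eigval A l) * ?v l i * ?v l j / ?d l)" by simp
  also have "\<dots> = (\<Sum>l<n. ?v l i * ?v l j + \<i> * of_real \<tau> * (?v l i * ?v l j / ?d l))"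
  proof (intro sum.cong refl)
    fix l
    have "of_real (eigval A l) / ?d l = 1 + \<i> * of_real \<tau> / ?d l"
      using denominator_nonzero[of "eigval A l"] by (simp add: field_simps)
    then have "?v l i * ?v l j * (of_real (eigval A l) / ?d l) = ?v l i * ?v l j * (1 + \<i> * of_real \<tau> / ?d l)"
      by (simp only:)
    then show "of_real (eigval A l) * ?v l i * ?v l j / ?d l = ?v l i * ?v l j + \<i> * of_real \<tau> * (?v l i * ?v l j / ?d l)"
      by (simp only: distrib_left mult_1_left mult_1_right times_divide_eq_right mult_ac)
  qed
  also have "\<dots> = of_real (\<Sum>l<n. eigvec A l i * eigvec A l j) + \<i> * of_real \<tau> * resolvent A \<tau> i j"
    by (simp only: sum.distrib resolvent_def dim sum_distrib_left of_real_sum of_real_mult)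
  finally show ?thesis unfolding eigvec_complete[OF i j] by (simp only: if_distrib[of complex_of_real] of_real_1 of_real_0)
qed

lemma resolvent_eq':
  assumes i: "i < n" and j: "j < n"
  shows "(\<Sum>k<n. resolvent A \<tau> i k * of_real (A $$ (k,j))) = (if i = j then 1 else 0) + \<i> * of_real \<tau> * resolvent A \<tau> i j"
proof -
  have "A $$ (k,j) = A $$ (j,k)" if "k < n" for k
    using arg_cong[OF sym, of "\<lambda>M. M $$ (k,j)"] carrier that j by simp
  then have "(\<Sum>k<n. resolvent A \<tau> i k * of_real (A $$ (k,j))) = (\<Sum>k<n. of_real (A $$ (j,k)) * resolvent A \<tau> k i)"
    by (intro sum.cong refl) (simp only: lessThan_iff resolvent_commute[of \<tau> i] mult.commute)
  also have "\<dots> = (if j = i then 1 else 0) + \<i> * of_real \<tau> * resolvent A \<tau> j i"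
    by (rule resolvent_eq[OF j i])
  also have "\<dots> = (if i = j then 1 else 0) + \<i> * of_real \<tau> * resolvent A \<tau> i j"
    by (simp only: resolvent_commute[of \<tau> j i] eq_commute[of j i])
  finally show ?thesis .
qed

text \<open>By Parseval a row has squared length at most that of a unit vector divided by \<tau>^2.
  A whole row thus costs no more than the crude bound for a single entry, which saves a factor n in
  every sum of products of entries.\<close>

lemma resolvent_row_bound:
  assumes i: "i < n"
  shows "(\<Sum>j<n. (cmod (resolvent A \<tau> i j))\<^sup>2) \<le> 1 / \<tau>\<^sup>2"
proof -
  let ?c = "\<lambda>k. of_real (eigvec A k i) / (of_real (eigval A k) - \<i> * complex_of_real \<tau>)"
  have "(\<Sum>j<n. (cmod (resolvent A \<tau> i j))\<^sup>2) = (\<Sum>k<n. (cmod (?c k))\<^sup>2)"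
    unfolding parseval[of ?c, symmetric] resolvent_def dim
    by (simp only: times_divide_eq_left times_divide_eq_right mult.commute)
  also have "\<dots> \<le> (\<Sum>k<n. (eigvec A k i * eigvec A k i) / \<tau>\<^sup>2)"
  proof (rule sum_mono)
    fix k
    have "(cmod (?c k))\<^sup>2 = (eigvec A k i * eigvec A k i) / ((eigval A k)\<^sup>2 + \<tau>\<^sup>2)"
      by (simp only: norm_divide power_divide cmod_denominator norm_of_real power2_abs power2_eq_square[of "eigvec _ _ _"])
    also have "\<dots> \<le> (eigvec A k i * eigvec A k i) / \<tau>\<^sup>2"
      using \<tau> by (intro divide_left_mono mult_pos_pos add_nonneg_pos) auto
    finally show "(cmod (?c k))\<^sup>2 \<le> (eigvec A k i * eigvec A k i) / \<tau>\<^sup>2" .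
  qed
  also have "\<dots> = 1 / \<tau>\<^sup>2"
    using i by (simp add: sum_divide_distrib[symmetric] eigvec_complete)
  finally show ?thesis .
qed

lemma resolvent_bound:
  assumes i: "i < n" and j: "j < n"
  shows "cmod (resolvent A \<tau> i j) \<le> 1 / \<tau>"
proof -
  have "(cmod (resolvent A \<tau> i j))\<^sup>2 \<le> (\<Sum>j<n. (cmod (resolvent A \<tau> i j))\<^sup>2)"
    using j by (intro member_le_sum[of j "{..<n}" "\<lambda>j. (cmod (resolvent A \<tau> i j))\<^sup>2"]) auto
  also have "\<dots> \<le> (1 / \<tau>)\<^sup>2" using resolvent_row_bound[OF i] by (simp add: power_divide)
  finally show ?thesis by (rule power2_le_imp_le) (use \<tau> in simp)
qed

text \<open>The double sum is the quadratic form of R at the all-ones vector, whose squared length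
  is n, and R has operator norm at most 1 / \<tau>. Entrywise bounds would give n^2 / \<tau>, too
  much to absorb a nonzero mean.\<close>

lemma resolvent_sum_bound: "cmod (\<Sum>i<n. \<Sum>j<n. resolvent A \<tau> i j) \<le> real n / \<tau>"
proof -
  let ?d = "\<lambda>k. of_real (eigval A k) - \<i> * complex_of_real \<tau>"
  have swap: "(\<Sum>i<n. \<Sum>j<n. \<Sum>k<n. f i j k) = (\<Sum>k<n. \<Sum>i<n. \<Sum>j<n. f i j k)"
    for f :: "nat \<Rightarrow> nat \<Rightarrow> nat \<Rightarrow> 'b :: comm_monoid_add"
  proof -
    have "(\<Sum>i<n. \<Sum>j<n. \<Sum>k<n. f i j k) = (\<Sum>i<n. \<Sum>k<n. \<Sum>j<n. f i j k)"
      by (rule sum.cong[OF refl], rule sum.swap)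
    also have "\<dots> = (\<Sum>k<n. \<Sum>i<n. \<Sum>j<n. f i j k)" by (rule sum.swap)
    finally show ?thesis .
  qed
  have "(\<Sum>i<n. \<Sum>j<n. resolvent A \<tau> i j) = (\<Sum>k<n. \<Sum>i<n. \<Sum>j<n. of_real (eigvec A k i) * of_real (eigvec A k j) / ?d k)"
    unfolding resolvent_def dim by (rule swap)
  also have "\<dots> = (\<Sum>k<n. of_real ((\<Sum>i<n. eigvec A k i) * (\<Sum>i<n. eigvec A k i)) / ?d k)"
    unfolding sum_product of_real_sum of_real_mult sum_divide_distrib ..
  also have "cmod \<dots> \<le> (\<Sum>k<n. ((\<Sum>i<n. eigvec A k i) * (\<Sum>i<n. eigvec A k i)) / \<tau>)"
  proof (rule sum_norm_le)
    fix k
    show "cmod (of_real ((\<Sum>i<n. eigvec A k i) * (\<Sum>i<n. eigvec A k i)) / ?d k) \<le> ((\<Sum>i<n. eigvec A k i) * (\<Sum>i<n. eigvec A k i)) / \<tau>"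
      using \<tau> cmod_denominator_ge[of "eigval A k"] denominator_nonzero[of "eigval A k"]
      unfolding norm_divide norm_of_real abs_mult_self_eq abs_mult by (intro divide_left_mono mult_pos_pos) auto
  qed
  also have "\<dots> = (\<Sum>i<n. \<Sum>j<n. \<Sum>k<n. eigvec A k i * eigvec A k j) / \<tau>"
    unfolding sum_divide_distrib[symmetric] sum_product
    by (rule arg_cong[of _ _ "\<lambda>x. x / \<tau>"], rule swap[symmetric])
  also have "\<dots> = real n / \<tau>" by (simp add: eigvec_complete)
  finally show ?thesis .
qed

lemma resolvent_trace_eq: "resolvent_trace A \<tau> = (\<Sum>k<n. 1 / (of_real (eigval A k) - \<i> * of_real \<tau>))"
proof -
  have "resolvent_trace A \<tau> = (\<Sum>k<n. of_real (\<Sum>i<n. eigvec A k i * eigvec A k i) / (of_real (eigval A k) - \<i> * of_real \<tau>))"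
    unfolding resolvent_trace_def resolvent_def dim by (subst sum.swap) (simp add: sum_divide_distrib)
  then show ?thesis by (simp add: eigvec_orthonormal)
qed

lemma Im_resolvent_trace: "Im (resolvent_trace A \<tau>) = (\<Sum>k<n. \<tau> / ((eigval A k)\<^sup>2 + \<tau>\<^sup>2))"
  by (simp add: resolvent_trace_eq Im_divide)

lemma resolvent_trace_bound: "cmod (resolvent_trace A \<tau>) \<le> real n / \<tau>"
  unfolding resolvent_trace_def using resolvent_bound by (intro order_trans[OF sum_norm_bound[of _ _ "1/\<tau>"]]) auto

lemma trace_product:
  "(\<Sum>i<n. \<Sum>j<n. of_real (A $$ (i,j)) * resolvent A \<tau> j i) = of_nat n + \<i> * of_real \<tau> * resolvent_trace A \<tau>"
proof -
  have "(\<Sum>i<n. \<Sum>j<n. of_real (A $$ (i,j)) * resolvent A \<tau> j i) = (\<Sum>i<n. 1 + \<i> * of_real \<tau> * resolvent A \<tau> i i)"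
    by (intro sum.cong refl) (simp add: resolvent_eq)
  then show ?thesis by (simp add: sum.distrib resolvent_trace_def sum_distrib_left)
qed

end

end

text \<open>R_A (B - A) R_B is evaluated with B R_B = 1 + i \<tau> R_B on the right and R_A A = 1 +
  i \<tau> R_A on the left; the terms i \<tau> R_A R_B cancel.\<close>

lemma resolvent_identity:
  assumes "symmetric_mat A n" "symmetric_mat B n" and \<tau>: "\<tau> > 0" and ij: "i < n" "j < n"
  shows "resolvent A \<tau> i j - resolvent B \<tau> i j
    = (\<Sum>k<n. \<Sum>l<n. resolvent A \<tau> i k * of_real (B $$ (k,l) - A $$ (k,l)) * resolvent B \<tau> l j)"
proof -
  interpret A: symmetric_mat A n by fact
  interpret B: symmetric_mat B n by fact
  have "(\<Sum>k<n. \<Sum>l<n. resolvent A \<tau> i k * of_real (B $$ (k,l) - A $$ (k,l)) * resolvent B \<tau> l j)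
    = (\<Sum>k<n. resolvent A \<tau> i k * (\<Sum>l<n. of_real (B $$ (k,l)) * resolvent B \<tau> l j))
    - (\<Sum>l<n. (\<Sum>k<n. resolvent A \<tau> i k * of_real (A $$ (k,l))) * resolvent B \<tau> l j)"
  proof -
    have "(\<Sum>l<n. (\<Sum>k<n. resolvent A \<tau> i k * of_real (A $$ (k,l))) * resolvent B \<tau> l j)
       = (\<Sum>k<n. \<Sum>l<n. resolvent A \<tau> i k * of_real (A $$ (k,l)) * resolvent B \<tau> l j)"
      unfolding sum_distrib_right by (rule sum.swap)
    then show ?thesis
      by (simp only: sum_distrib_left sum_subtractf[symmetric] of_real_diff right_diff_distrib left_diff_distrib mult.assoc)
  qed
  also have "(\<Sum>k<n. resolvent A \<tau> i k * (\<Sum>l<n. of_real (B $$ (k,l)) * resolvent B \<tau> l j))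
     = (\<Sum>k<n. (if k = j then resolvent A \<tau> i k else 0) + \<i> * of_real \<tau> * (resolvent A \<tau> i k * resolvent B \<tau> k j))"
  proof (rule sum.cong[OF refl])
    fix k assume "k \<in> {..<n}"
    then have "(\<Sum>l<n. of_real (B $$ (k,l)) * resolvent B \<tau> l j) = (if k = j then 1 else 0) + \<i> * of_real \<tau> * resolvent B \<tau> k j"
      using B.resolvent_eq[OF \<tau> _ ij(2)] by simp
    then show "resolvent A \<tau> i k * (\<Sum>l<n. of_real (B $$ (k,l)) * resolvent B \<tau> l j)
      = (if k = j then resolvent A \<tau> i k else 0) + \<i> * of_real \<tau> * (resolvent A \<tau> i k * resolvent B \<tau> k j)"
      by (cases "k = j") (simp_all add: distrib_left mult_ac)
  qed
  also have "(\<Sum>l<n. (\<Sum>k<n. resolvent A \<tau> i k * of_real (A $$ (k,l))) * resolvent B \<tau> l j)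
     = (\<Sum>l<n. (if i = l then resolvent B \<tau> l j else 0) + \<i> * of_real \<tau> * (resolvent A \<tau> i l * resolvent B \<tau> l j))"
  proof (rule sum.cong[OF refl])
    fix l assume "l \<in> {..<n}"
    then have "(\<Sum>k<n. resolvent A \<tau> i k * of_real (A $$ (k,l))) = (if i = l then 1 else 0) + \<i> * of_real \<tau> * resolvent A \<tau> i l"
      using A.resolvent_eq'[OF \<tau> ij(1)] by simp
    then show "(\<Sum>k<n. resolvent A \<tau> i k * of_real (A $$ (k,l))) * resolvent B \<tau> l j
      = (if i = l then resolvent B \<tau> l j else 0) + \<i> * of_real \<tau> * (resolvent A \<tau> i l * resolvent B \<tau> l j)"
      by (cases "i = l") (simp_all add: algebra_simps)
  qed
  finally have "(\<Sum>k<n. \<Sum>l<n. resolvent A \<tau> i k * of_real (B $$ (k,l) - A $$ (k,l)) * resolvent B \<tau> l j)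
    = resolvent A \<tau> i j - resolvent B \<tau> i j"
    using ij by (simp add: sum.distrib)
  then show ?thesis ..
qed

text \<open>In use, \<open>A\<close> contains the edge {a, b} and \<open>B\<close> does not. Since
  \<open>y\<close> is an entry of \<open>B - A\<close>, a positive edge has \<open>y = -1\<close>
  and a negative one \<open>y = 1\<close>.\<close>

locale edge_perturbation = A: symmetric_mat A n + B: symmetric_mat B n for A B n +
  fixes a b :: nat and y \<tau> :: real
  assumes ab: "a < n" "b < n" "a \<noteq> b" and \<tau>: "\<tau> > 0" and y: "\<bar>y\<bar> \<le> 1"
    and diff: "\<And>k l. k < n \<Longrightarrow> l < n \<Longrightarrow>
      B $$ (k,l) - A $$ (k,l) = (if (k = a \<and> l = b) \<or> (k = b \<and> l = a) then y else 0)"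
begin

lemma resolvent_diff:
  assumes ij: "i < n" "j < n"
  shows "resolvent A \<tau> i j - resolvent B \<tau> i j
    = of_real y * (resolvent A \<tau> i a * resolvent B \<tau> b j + resolvent A \<tau> i b * resolvent B \<tau> a j)"
proof -
  have "resolvent A \<tau> i j - resolvent B \<tau> i j
    = (\<Sum>k<n. \<Sum>l<n. (if l = b then if k = a then resolvent A \<tau> i a * of_real y * resolvent B \<tau> b j else 0 else 0)
       + (if l = a then if k = b then resolvent A \<tau> i b * of_real y * resolvent B \<tau> a j else 0 else 0))"
    unfolding resolvent_identity[OF A.symmetric_mat_axioms B.symmetric_mat_axioms \<tau> ij]
    using ab by (intro sum.cong refl) (auto simp: diff)
  also have "\<dots> = resolvent A \<tau> i a * of_real y * resolvent B \<tau> b j + resolvent A \<tau> i b * of_real y * resolvent B \<tau> a j"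
    using ab by (simp add: sum.distrib)
  finally show ?thesis by (simp add: algebra_simps)
qed

lemma resolvent_diff_bound:
  assumes ij: "i < n" "j < n"
  shows "cmod (resolvent A \<tau> i j - resolvent B \<tau> i j) \<le> 2 / \<tau>\<^sup>2"
proof -
  have "cmod (resolvent A \<tau> i c * resolvent B \<tau> d j) \<le> 1/\<tau> * (1/\<tau>)" if "c < n" "d < n" for c d
    unfolding norm_mult
    by (rule mult_mono) (use \<tau> ij that in \<open>auto intro: A.resolvent_bound B.resolvent_bound\<close>)
  then have "cmod (resolvent A \<tau> i j - resolvent B \<tau> i j) \<le> 1 * (1/\<tau> * (1/\<tau>) + 1/\<tau> * (1/\<tau>))"
    unfolding resolvent_diff[OF ij] norm_mult[of "of_real y"] norm_of_real using y ab
    by (intro mult_mono norm_triangle_le add_mono) auto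
  then show ?thesis by (simp add: power2_eq_square)
qed

text \<open>The inequality 2 u v \<le> u^2 + v^2 reduces the sum to two row bounds, so n summands
  together are still O(1 / \<tau>^2). Hence one edge moves the trace by O(1 / \<tau>^2) rather than
  O(n / \<tau>^2).\<close>

lemma column_product_bound:
  assumes cd: "c < n" "d < n"
  shows "cmod (\<Sum>i<n. resolvent A \<tau> i c * resolvent B \<tau> d i) \<le> 1 / \<tau>\<^sup>2"
proof -
  have "cmod (\<Sum>i<n. resolvent A \<tau> i c * resolvent B \<tau> d i)
     \<le> (\<Sum>i<n. ((cmod (resolvent A \<tau> c i))\<^sup>2 + (cmod (resolvent B \<tau> d i))\<^sup>2) / 2)"
  proof (rule sum_norm_le)
    fix i
    show "cmod (resolvent A \<tau> i c * resolvent B \<tau> d i) \<le> ((cmod (resolvent A \<tau> c i))\<^sup>2 + (cmod (resolvent B \<tau> d i))\<^sup>2) / 2"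
      using sum_squares_bound[of "cmod (resolvent A \<tau> c i)" "cmod (resolvent B \<tau> d i)"]
      by (simp add: norm_mult A.resolvent_commute[of _ i])
  qed
  also have "\<dots> = ((\<Sum>i<n. (cmod (resolvent A \<tau> c i))\<^sup>2) + (\<Sum>i<n. (cmod (resolvent B \<tau> d i))\<^sup>2)) / 2"
    by (simp add: sum.distrib sum_divide_distrib[symmetric])
  also have "\<dots> \<le> (1 / \<tau>\<^sup>2 + 1 / \<tau>\<^sup>2) / 2"
    by (intro divide_right_mono add_mono A.resolvent_row_bound B.resolvent_row_bound \<tau> cd) auto
  finally show ?thesis by simp
qed

lemma trace_diff_bound: "cmod (resolvent_trace A \<tau> - resolvent_trace B \<tau>) \<le> 2 / \<tau>\<^sup>2"
proof -
  have "resolvent_trace A \<tau> - resolvent_trace B \<tau>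
    = (\<Sum>i<n. of_real y * (resolvent A \<tau> i a * resolvent B \<tau> b i + resolvent A \<tau> i b * resolvent B \<tau> a i))"
    unfolding resolvent_trace_def A.dim B.dim sum_subtractf[symmetric]
    by (intro sum.cong refl resolvent_diff) auto
  also have "\<dots> = of_real y * ((\<Sum>i<n. resolvent A \<tau> i a * resolvent B \<tau> b i) + (\<Sum>i<n. resolvent A \<tau> i b * resolvent B \<tau> a i))"
    unfolding sum_distrib_left[symmetric] sum.distrib ..
  finally have eq: "resolvent_trace A \<tau> - resolvent_trace B \<tau> = \<dots>" .
  have "cmod (resolvent_trace A \<tau> - resolvent_trace B \<tau>) \<le> 1 * (1/\<tau>\<^sup>2 + 1/\<tau>\<^sup>2)"
    unfolding eq norm_mult norm_of_real using y ab
    by (intro mult_mono norm_triangle_le add_mono column_product_bound) auto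
  then show ?thesis by simp
qed

end

section \<open>Resampling an edge\<close>

text \<open>The quantity Q of the overview before rescaling: with \<tau> = t n^(1/2) and z = S /
  n^(1/2), the two fractions are i t z and s z^2.\<close>

definition semicircle_defect :: "real \<Rightarrow> real mat \<Rightarrow> real \<Rightarrow> complex" where
  "semicircle_defect s A \<tau> = 1 + \<i> * of_real \<tau> * resolvent_trace A \<tau> / of_nat (dim_row A)
     + of_real s * (resolvent_trace A \<tau>)\<^sup>2 / of_nat (dim_row A)"

text \<open>Both fractions follow from the trace bound. At \<tau> = t n^(1/2) the bound is 2 + 1 /
  t^2, free of n.\<close>

lemma (in symmetric_mat) semicircle_defect_bound:
  assumes n: "n > 0" and \<tau>: "\<tau> > 0" and s: "0 \<le> s" "s \<le> 1"
  shows "cmod (semicircle_defect s A \<tau>) \<le> 2 + n / \<tau>\<^sup>2"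
proof -
  let ?S = "resolvent_trace A \<tau>"
  have S: "cmod ?S \<le> real n / \<tau>" by (rule resolvent_trace_bound[OF \<tau>])
  have "cmod (\<i> * of_real \<tau> * ?S / of_nat n) \<le> 1"
    using S n \<tau> by (simp add: norm_mult norm_divide field_simps)
  moreover have "cmod (of_real s * ?S\<^sup>2 / of_nat n) \<le> n / \<tau>\<^sup>2"
  proof -
    have "cmod (of_real s * ?S\<^sup>2) \<le> 1 * (real n / \<tau>)\<^sup>2"
      unfolding norm_mult norm_power norm_of_real using S s by (intro mult_mono power_mono) auto
    then show ?thesis using n by (simp add: norm_divide field_simps power2_eq_square)
  qed
  ultimately show ?thesis
    unfolding semicircle_defect_def dim using norm_triangle_ineq[of 1 "\<i> * of_real \<tau> * ?S / of_nat n"]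
      norm_triangle_ineq[of "1 + \<i> * of_real \<tau> * ?S / of_nat n" "of_real s * ?S\<^sup>2 / of_nat n"] by simp
qed

text \<open>To leading order \<open>- defect_slope\<close> is the derivative of \<open>defect_entry\<close> in the direction of the edge \<open>{a, b}\<close>.\<close>

definition defect_entry :: "real \<Rightarrow> real \<Rightarrow> nat \<Rightarrow> nat \<Rightarrow> real mat \<Rightarrow> complex" where
  "defect_entry s \<tau> a b A = cnj (semicircle_defect s A \<tau>) * resolvent A \<tau> b a"

definition defect_slope :: "real \<Rightarrow> real \<Rightarrow> nat \<Rightarrow> nat \<Rightarrow> real mat \<Rightarrow> complex" where
  "defect_slope s \<tau> a b A = cnj (semicircle_defect s A \<tau>) *
     (resolvent A \<tau> a a * resolvent A \<tau> b b + (resolvent A \<tau> a b)\<^sup>2)"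

lemma cmod_mult_le: "cmod x \<le> u \<Longrightarrow> cmod y \<le> v \<Longrightarrow> cmod (x * y) \<le> u * v"
  unfolding norm_mult by (intro mult_mono) (auto intro: order_trans[OF norm_ge_zero])

lemma cmod_add_le: "cmod x \<le> u \<Longrightarrow> cmod y \<le> v \<Longrightarrow> cmod (x + y) \<le> u + v"
  by (rule norm_triangle_le) simp

context edge_perturbation
begin

text \<open>The trace changes by O(1 / \<tau>^2); the quadratic term is handled through (S - S') (S
  + S') with |S + S'| \<le> 2 n / \<tau>. At \<tau> = t n^(1/2) the result is O(n^(-3/2)), small
  enough to treat the defect as constant while one edge varies.\<close>

lemma defect_diff_bound:
  assumes s: "0 \<le> s" "s \<le> 1"
  shows "cmod (semicircle_defect s A \<tau> - semicircle_defect s B \<tau>) \<le> 2 / (n * \<tau>) + 4 / \<tau> ^ 3"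
proof -
  let ?S = "resolvent_trace A \<tau>" and ?S' = "resolvent_trace B \<tau>"
  have n: "n > 0" using ab by simp
  have "semicircle_defect s A \<tau> - semicircle_defect s B \<tau>
    = (\<i> * of_real \<tau>) * (?S - ?S') / of_nat n + of_real s * ((?S - ?S') * (?S + ?S')) / of_nat n"
    using n by (simp add: semicircle_defect_def field_simps power2_eq_square)
  also have "cmod \<dots> \<le> (\<tau> * (2 / \<tau>\<^sup>2)) / n + (1 * ((2 / \<tau>\<^sup>2) * (n / \<tau> + n / \<tau>))) / n"
  proof (rule cmod_add_le)
    have "cmod ((\<i> * of_real \<tau>) * (?S - ?S')) \<le> \<tau> * (2 / \<tau>\<^sup>2)"
      by (intro cmod_mult_le trace_diff_bound) (use \<tau> in \<open>simp add: norm_mult\<close>)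
    then show "cmod ((\<i> * of_real \<tau>) * (?S - ?S') / of_nat n) \<le> (\<tau> * (2 / \<tau>\<^sup>2)) / n"
      unfolding norm_divide norm_of_nat by (rule divide_right_mono) simp
    have "cmod (of_real s * ((?S - ?S') * (?S + ?S'))) \<le> 1 * ((2 / \<tau>\<^sup>2) * (n / \<tau> + n / \<tau>))"
      by (intro cmod_mult_le cmod_add_le trace_diff_bound A.resolvent_trace_bound B.resolvent_trace_bound \<tau>)
        (use s in auto)
    then show "cmod (of_real s * ((?S - ?S') * (?S + ?S')) / of_nat n) \<le> (1 * ((2 / \<tau>\<^sup>2) * (n / \<tau> + n / \<tau>))) / n"
      unfolding norm_divide norm_of_nat by (rule divide_right_mono) simp
  qed
  also have "\<dots> = 2 / (n * \<tau>) + 4 / \<tau> ^ 3"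
    using n \<tau> by (simp add: field_simps power2_eq_square power3_eq_cube)
  finally show ?thesis .
qed

text \<open>Freezing the defect costs \<open>defect_diff_bound\<close> times one resolvent entry.
  What remains is the second-order term of the resolvent entry in \<open>y\<close>, which is cubic
  in 1 / \<tau>.\<close>

lemma defect_entry_expansion:
  assumes s: "0 \<le> s" "s \<le> 1"
  shows "cmod (defect_entry s \<tau> a b A - defect_entry s \<tau> a b B - of_real y * defect_slope s \<tau> a b B)
    \<le> (2 / (n * \<tau>) + 4 / \<tau> ^ 3) / \<tau> + 4 * (2 + n / \<tau>\<^sup>2) / \<tau> ^ 3"
proof -
  let ?Q = "cnj (semicircle_defect s A \<tau>)" and ?Q' = "cnj (semicircle_defect s B \<tau>)"
  define d K where "d = 2 / (n * \<tau>) + 4 / \<tau> ^ 3" and "K = 2 + n / \<tau>\<^sup>2"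
  have n: "n > 0" using ab by simp
  have Qd: "cmod (?Q - ?Q') \<le> d"
    unfolding d_def using defect_diff_bound[OF s] by (simp only: complex_cnj_diff[symmetric] complex_mod_cnj)
  have Qb: "cmod ?Q' \<le> K"
    unfolding complex_mod_cnj K_def by (rule B.semicircle_defect_bound[OF n \<tau> s])
  have y1: "cmod (of_real y) \<le> 1" using y by simp
  have "defect_entry s \<tau> a b A - defect_entry s \<tau> a b B - of_real y * defect_slope s \<tau> a b B
    = (?Q - ?Q') * resolvent A \<tau> b a + ?Q' * (resolvent A \<tau> b a - resolvent B \<tau> b a
       - of_real y * (resolvent B \<tau> a a * resolvent B \<tau> b b + (resolvent B \<tau> a b)\<^sup>2))"
    by (simp add: defect_entry_def defect_slope_def algebra_simps)
  \<comment> \<open>\<open>resolvent_diff\<close> is exact but mixes the two matrices. Subtracting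
    the products taken from \<open>B\<close> alone leaves differences of resolvents, to which it
    applies once more in the form of \<open>resolvent_diff_bound\<close>.\<close>
  also have "resolvent A \<tau> b a - resolvent B \<tau> b a
       - of_real y * (resolvent B \<tau> a a * resolvent B \<tau> b b + (resolvent B \<tau> a b)\<^sup>2)
    = of_real y * ((resolvent A \<tau> b a - resolvent B \<tau> b a) * resolvent B \<tau> b a
        + (resolvent A \<tau> b b - resolvent B \<tau> b b) * resolvent B \<tau> a a)"
  proof -
    have alg: "r - r' - w * (v * u' + r'\<^sup>2) = w * ((r - r') * r' + (u - u') * v)"
      if "r - r' = w * (r * r' + u * v)" for r r' w u u' v :: complex
    proof -
      have "r - r' - w * (v * u' + r'\<^sup>2) = w * (r * r' + u * v) - w * (v * u' + r'\<^sup>2)"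
        by (rule arg_cong[OF that, of "\<lambda>x. x - w * (v * u' + r'\<^sup>2)"])
      also have "\<dots> = w * ((r - r') * r' + (u - u') * v)" by (simp add: algebra_simps power2_eq_square)
      finally show ?thesis .
    qed
    show ?thesis
      unfolding B.resolvent_commute[of \<tau> a b] by (rule alg) (rule resolvent_diff[OF ab(2,1)])
  qed
  also have "cmod ((?Q - ?Q') * resolvent A \<tau> b a + ?Q' * (of_real y * ((resolvent A \<tau> b a - resolvent B \<tau> b a) * resolvent B \<tau> b a
        + (resolvent A \<tau> b b - resolvent B \<tau> b b) * resolvent B \<tau> a a)))
    \<le> d * (1 / \<tau>) + K * (1 * ((2 / \<tau>\<^sup>2) * (1 / \<tau>) + (2 / \<tau>\<^sup>2) * (1 / \<tau>)))"
    by (intro cmod_add_le cmod_mult_le resolvent_diff_bound A.resolvent_bound[OF \<tau>] B.resolvent_bound[OF \<tau>] ab Qd Qb y1)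
  also have "\<dots> = d / \<tau> + 4 * K / \<tau> ^ 3"
    by (simp add: power2_eq_square power3_eq_cube mult_ac)
  finally show ?thesis unfolding d_def K_def .
qed

text \<open>The slope already multiplies a first-order quantity, so replacing it by its value
  without the edge needs only a zeroth-order comparison; each product is telescoped into differences
  of single factors.\<close>

lemma defect_slope_diff:
  assumes s: "0 \<le> s" "s \<le> 1"
  shows "cmod (defect_slope s \<tau> a b A - defect_slope s \<tau> a b B)
    \<le> 2 * (2 / (n * \<tau>) + 4 / \<tau> ^ 3) / \<tau>\<^sup>2 + 8 * (2 + n / \<tau>\<^sup>2) / \<tau> ^ 3"
proof -
  let ?Q = "cnj (semicircle_defect s A \<tau>)" and ?Q' = "cnj (semicircle_defect s B \<tau>)"
  let ?R = "resolvent A \<tau>" and ?R' = "resolvent B \<tau>"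
  define d K where "d = 2 / (n * \<tau>) + 4 / \<tau> ^ 3" and "K = 2 + n / \<tau>\<^sup>2"
  have n: "n > 0" using ab by simp
  have Qd: "cmod (?Q - ?Q') \<le> d"
    unfolding d_def using defect_diff_bound[OF s] by (simp only: complex_cnj_diff[symmetric] complex_mod_cnj)
  have Qb: "cmod ?Q' \<le> K"
    unfolding complex_mod_cnj K_def by (rule B.semicircle_defect_bound[OF n \<tau> s])
  have y1: "cmod (of_real y) \<le> 1" using y by simp
  have eq: "defect_slope s \<tau> a b A - defect_slope s \<tau> a b B
    = (?Q - ?Q') * (?R a a * ?R b b + ?R a b * ?R a b)
      + ?Q' * ((?R a a - ?R' a a) * ?R b b + ?R' a a * (?R b b - ?R' b b) + (?R a b - ?R' a b) * ?R a b + ?R' a b * (?R a b - ?R' a b))"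
  proof -
    have 1: "x * v - x' * v' = (x - x') * v + x' * (v - v')" for x x' v v' :: complex
      by (simp only: left_diff_distrib right_diff_distrib) simp
    show ?thesis
      unfolding defect_slope_def power2_eq_square
        1[of ?Q "?R a a * ?R b b + ?R a b * ?R a b" ?Q' "?R' a a * ?R' b b + ?R' a b * ?R' a b"]
        add_diff_add 1[of "?R a a" "?R b b"] 1[of "?R a b" "?R a b"] by (simp only: add.assoc)
  qed
  have "cmod (defect_slope s \<tau> a b A - defect_slope s \<tau> a b B) \<le> d * (1 / \<tau> * (1 / \<tau>) + 1 / \<tau> * (1 / \<tau>))
      + K * ((2 / \<tau>\<^sup>2) * (1 / \<tau>) + (1 / \<tau>) * (2 / \<tau>\<^sup>2) + (2 / \<tau>\<^sup>2) * (1 / \<tau>) + (1 / \<tau>) * (2 / \<tau>\<^sup>2))"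
    unfolding eq by (intro cmod_add_le cmod_mult_le resolvent_diff_bound A.resolvent_bound[OF \<tau>] B.resolvent_bound[OF \<tau>] ab Qd Qb y1)
  also have "\<dots> = 2 * d / \<tau>\<^sup>2 + 8 * K / \<tau> ^ 3"
    by (simp add: power2_eq_square power3_eq_cube mult_ac)
  finally show ?thesis unfolding d_def K_def .
qed

end

lemma symmetric_mat_signed_adjacency: "symmetric_mat (signed_adjacency n G) n"
  by (rule symmetric_mat.intro) (simp_all add: symmetric_signed_adjacency, simp add: signed_adjacency_def)

lemma edge_perturbation_signed_adjacency:
  assumes "i < n" "j < n" "i \<noteq> j" "\<tau> > 0" "v = Positive \<and> y = -1 \<or> v = Negative \<and> y = 1"
  shows "edge_perturbation (signed_adjacency n (G({i,j} := Some v))) (signed_adjacency n (G({i,j} := None))) n i j y \<tau>"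
  by (intro edge_perturbation.intro edge_perturbation_axioms.intro symmetric_mat_signed_adjacency)
    (use assms in \<open>auto simp: signed_adjacency_def doubleton_eq_iff\<close>)

text \<open>For an edge e, the conditional expectation of \<open>f\<close> given the state of all
  other pairs.\<close>

definition resample :: "real \<Rightarrow> real \<Rightarrow> nat set \<Rightarrow> (signed_graph \<Rightarrow> complex) \<Rightarrow> signed_graph \<Rightarrow> complex" where
  "resample p q e f G = of_real p * f (G(e := Some Positive)) + of_real q * f (G(e := Some Negative))
     + of_real (1 - (p + q)) * f (G(e := None))"

text \<open>The bound of \<open>defect_entry_expansion\<close> plus that of
  \<open>defect_slope_diff\<close>; of order n^(-3/2) at \<tau> = t n^(1/2).\<close>

definition resample_error :: "nat \<Rightarrow> real \<Rightarrow> real" where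
  "resample_error n \<tau> = (2 / (n * \<tau>) + 4 / \<tau> ^ 3) / \<tau> + 4 * (2 + n / \<tau>\<^sup>2) / \<tau> ^ 3
     + (2 * (2 / (n * \<tau>) + 4 / \<tau> ^ 3) / \<tau>\<^sup>2 + 8 * (2 + n / \<tau>\<^sup>2) / \<tau> ^ 3)"

text \<open>A discrete integration by parts. Let x be the entry of the edge, with mean m, and write
  the defect entry as H - x T up to a small error, with H and T taken without the edge. Averaging (x
  - m) (H - x T) gives -s T, because E (x - m) = 0 and E ((x - m) x) = s; the added slope term
  cancels it, and only remainders survive.\<close>

lemma resample_defect:
  fixes p q :: real
  assumes pq: "p \<ge> 0" "q \<ge> 0" "p + q \<le> 1" and ij: "i < n" "j < n" "i \<noteq> j" and \<tau>: "\<tau> > 0"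
  defines "s \<equiv> p + q - (p - q)\<^sup>2"
  shows "cmod (resample p q {i,j} (\<lambda>G. let A = signed_adjacency n G in
      of_real (A $$ (i,j)) * defect_entry s \<tau> i j A - of_real (p - q) * defect_entry s \<tau> i j A
      + of_real s * defect_slope s \<tau> i j A) G) \<le> resample_error n \<tau>"
proof -
  define Ap Am A0 where "Ap = signed_adjacency n (G({i,j} := Some Positive))"
    and "Am = signed_adjacency n (G({i,j} := Some Negative))" and "A0 = signed_adjacency n (G({i,j} := None))"
  have P: "edge_perturbation Ap A0 n i j (-1) \<tau>" and M: "edge_perturbation Am A0 n i j 1 \<tau>"
    unfolding Ap_def Am_def A0_def using ij \<tau> by (auto intro: edge_perturbation_signed_adjacency)
  have ent: "Ap $$ (i,j) = 1" "Am $$ (i,j) = -1" "A0 $$ (i,j) = 0"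
    using ij by (auto simp: Ap_def Am_def A0_def signed_adjacency_def)
  let ?H = "defect_entry s \<tau> i j" and ?T = "defect_slope s \<tau> i j" and ?m = "p - q"
  have mp: "0 \<le> 1 - ?m" "0 \<le> 1 + ?m" using pq by auto
  \<comment> \<open>Besides showing that s is nonnegative, this says that the weights of the
    first-order remainders for the two signs add up to exactly s.\<close>
  have sm: "s = p * (1 - ?m) + q * (1 + ?m)" by (simp add: s_def algebra_simps power2_eq_square)
  then have s0: "s \<ge> 0" using mp pq by auto
  have s1: "s \<le> 1" using pq zero_le_power2[of "p - q"] unfolding s_def by linarith
  define E1 where "E1 = (2 / (n * \<tau>) + 4 / \<tau> ^ 3) / \<tau> + 4 * (2 + n / \<tau>\<^sup>2) / \<tau> ^ 3"
  define E2 where "E2 = 2 * (2 / (n * \<tau>) + 4 / \<tau> ^ 3) / \<tau>\<^sup>2 + 8 * (2 + n / \<tau>\<^sup>2) / \<tau> ^ 3"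
  have E: "E1 \<ge> 0" "E2 \<ge> 0" using \<tau> by (auto simp: E1_def E2_def)
  have hP: "cmod (?H Ap - ?H A0 - of_real (-1) * ?T A0) \<le> E1"
    unfolding E1_def by (rule edge_perturbation.defect_entry_expansion[OF P s0 s1])
  have hM: "cmod (- (?H Am - ?H A0 - of_real 1 * ?T A0)) \<le> E1"
    unfolding E1_def norm_minus_cancel by (rule edge_perturbation.defect_entry_expansion[OF M s0 s1])
  have tP: "cmod (?T Ap - ?T A0) \<le> E2"
    unfolding E2_def by (rule edge_perturbation.defect_slope_diff[OF P s0 s1])
  have tM: "cmod (?T Am - ?T A0) \<le> E2"
    unfolding E2_def by (rule edge_perturbation.defect_slope_diff[OF M s0 s1])
  have norms: "cmod (of_real (p * (1 - ?m))) \<le> p * (1 - ?m)" "cmod (of_real (q * (1 + ?m))) \<le> q * (1 + ?m)"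
    "cmod (of_real s) \<le> 1" "cmod (of_real p) \<le> p" "cmod (of_real q) \<le> q"
    unfolding norm_of_real using pq mp s0 s1 by (auto simp: abs_mult)
  \<comment> \<open>The three weights of \<open>?m\<close>-centred entries sum to 0, which allows
    \<open>?H A0\<close> to be subtracted everywhere; by \<open>sm\<close> the terms in
    \<open>?T A0\<close> then cancel as well.\<close>
  have "resample p q {i,j} (\<lambda>G. let A = signed_adjacency n G in
      of_real (A $$ (i,j)) * ?H A - of_real ?m * ?H A + of_real s * ?T A) G
    = of_real (p * (1 - ?m)) * (?H Ap - ?H A0 - of_real (-1) * ?T A0)
      + of_real (q * (1 + ?m)) * - (?H Am - ?H A0 - of_real 1 * ?T A0)
      + of_real s * (of_real p * (?T Ap - ?T A0) + of_real q * (?T Am - ?T A0))"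
    unfolding resample_def Let_def Ap_def[symmetric] Am_def[symmetric] A0_def[symmetric] ent
    by (simp add: s_def power2_eq_square algebra_simps)
  also have "cmod \<dots> \<le> (p * (1 - ?m)) * E1 + (q * (1 + ?m)) * E1 + 1 * (p * E2 + q * E2)"
    by (intro cmod_add_le cmod_mult_le norms hP hM tP tM)
  also have "\<dots> = s * E1 + (p + q) * E2" by (simp add: sm algebra_simps)
  also have "\<dots> \<le> 1 * E1 + 1 * E2" using E s1 pq by (intro add_mono mult_right_mono) auto
  finally show ?thesis by (simp add: E1_def E2_def resample_error_def)
qed

section \<open>Averages over the random signed graph\<close>

lemma set_edge_pmf: "set_pmf (edge_pmf p q) \<subseteq> {Some Positive, Some Negative, None}"
proof
  fix x :: "sign option"
  show "x \<in> {Some Positive, Some Negative, None}"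
  proof (cases x)
    case (Some y)
    then show ?thesis by (cases y) auto
  qed simp
qed

text \<open>Finite support makes every function of the graph integrable and turns expectations into
  finite sums, which later commute with Lebesgue integrals.\<close>

lemma finite_set_random_signed_graph: "finite (set_pmf (random_signed_graph n p q))"
  unfolding random_signed_graph_def set_Pi_pmf[OF finite_vertex_pairs]
  by (intro finite_PiE_dflt finite_vertex_pairs) (auto intro: finite_subset[OF set_edge_pmf])

lemma integrable_random_signed_graph [simp]:
  fixes f :: "signed_graph \<Rightarrow> 'b :: {banach, second_countable_topology}"
  shows "integrable (measure_pmf (random_signed_graph n p q)) f"
  by (rule integrable_measure_pmf_finite[OF finite_set_random_signed_graph])

text \<open>The tower property: by independence the graph is drawn by first fixing all pairs other
  than \<open>e\<close> and then overwriting \<open>e\<close>, and a resampled function does not see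
  the overwritten value.\<close>

lemma expectation_resample:
  fixes f :: "signed_graph \<Rightarrow> complex"
  assumes pq: "p \<ge> 0" "q \<ge> 0" "p + q \<le> 1" and e: "e \<in> vertex_pairs n"
  shows "measure_pmf.expectation (random_signed_graph n p q) (resample p q e f)
    = measure_pmf.expectation (random_signed_graph n p q) f"
proof -
  define N where "N = Pi_pmf (vertex_pairs n - {e}) None (\<lambda>_. edge_pmf p q)"
  have fin: "finite (set_pmf N)"
    unfolding N_def by (subst set_Pi_pmf)
      (auto intro!: finite_PiE_dflt finite_vertex_pairs finite_Diff intro: finite_subset[OF set_edge_pmf])
  have int: "integrable (measure_pmf N) g" for g :: "signed_graph \<Rightarrow> complex"
    by (rule integrable_measure_pmf_finite[OF fin])
  have V: "random_signed_graph n p q = bind_pmf (edge_pmf p q) (\<lambda>y. map_pmf (\<lambda>h. h(e := y)) N)"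
  proof -
    have "random_signed_graph n p q = Pi_pmf (insert e (vertex_pairs n - {e})) None (\<lambda>_. edge_pmf p q)"
      unfolding random_signed_graph_def insert_Diff[OF e] ..
    also have "\<dots> = bind_pmf (edge_pmf p q) (\<lambda>y. bind_pmf N (\<lambda>h. return_pmf (h(e := y))))"
      unfolding N_def by (rule Pi_pmf_insert') (auto simp: finite_vertex_pairs)
    finally show ?thesis unfolding map_pmf_def .
  qed
  have E: "measure_pmf.expectation (random_signed_graph n p q) g
    = of_real p * measure_pmf.expectation N (\<lambda>h. g (h(e := Some Positive)))
    + of_real q * measure_pmf.expectation N (\<lambda>h. g (h(e := Some Negative)))
    + of_real (1 - (p + q)) * measure_pmf.expectation N (\<lambda>h. g (h(e := None)))" for g :: "signed_graph \<Rightarrow> complex"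
  proof -
    have "measure_pmf.expectation (random_signed_graph n p q) g
      = (\<Sum>y\<in>{Some Positive, Some Negative, None}. pmf (edge_pmf p q) y *\<^sub>R
           measure_pmf.expectation (map_pmf (\<lambda>h. h(e := y)) N) g)"
      unfolding V by (rule pmf_expectation_bind[OF _ _ set_edge_pmf]) (simp_all add: fin)
    also have "\<dots> = (\<Sum>y\<in>{Some Positive, Some Negative, None}. of_real (pmf (edge_pmf p q) y) *
           measure_pmf.expectation N (\<lambda>h. g (h(e := y))))"
      unfolding integral_map_pmf scaleR_conv_of_real ..
    finally show ?thesis by (simp add: pmf_edge_pmf[OF pq])
  qed
  have "measure_pmf.expectation (random_signed_graph n p q) (resample p q e f)
    = measure_pmf.expectation N (resample p q e f)"
  proof -
    have "resample p q e f (h(e := y)) = resample p q e f h" for h y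
      by (simp add: resample_def)
    then have "measure_pmf.expectation (random_signed_graph n p q) (resample p q e f)
      = (of_real p + of_real q + of_real (1 - (p + q))) * measure_pmf.expectation N (resample p q e f)"
      unfolding E by (simp only: distrib_right)
    then show ?thesis by simp
  qed
  also have "\<dots> = measure_pmf.expectation (random_signed_graph n p q) f"
    unfolding E[of f] resample_def[abs_def]
    by (simp only: Bochner_Integration.integral_add[OF int int] integral_mult_right_zero)
  finally show ?thesis .
qed

lemma cmod_expectation_le:
  fixes f :: "signed_graph \<Rightarrow> complex"
  assumes "\<And>G. cmod (f G) \<le> c"
  shows "cmod (measure_pmf.expectation (random_signed_graph n p q) f) \<le> c"
proof -
  have "cmod (measure_pmf.expectation (random_signed_graph n p q) f)
    \<le> measure_pmf.expectation (random_signed_graph n p q) (\<lambda>G. cmod (f G))"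
    by (rule integral_norm_bound)
  also have "\<dots> \<le> c"
    by (rule measure_pmf.integral_le_const) (use assms in auto)
  finally show ?thesis .
qed

lemma cmod_expectation_resample_le:
  assumes pq: "p \<ge> 0" "q \<ge> 0" "p + q \<le> 1" and e: "e \<in> vertex_pairs n"
    and "\<And>G. cmod (resample p q e f G) \<le> c"
  shows "cmod (measure_pmf.expectation (random_signed_graph n p q) f) \<le> c"
  by (subst expectation_resample[OF pq e, symmetric]) (rule cmod_expectation_le[OF assms(5)])

text \<open>n Q equals tr (A R) + s S^2, written as a double sum over i, j. Only pairs with i
  \<noteq> j are edges that can be resampled, so the terms centred by m and corrected by the slope
  are kept there, and everything added or missing is gathered in the last two lines.\<close>

lemma (in symmetric_mat) offdiagonal_decomposition:
  fixes m s \<tau> :: real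
  assumes n: "n > 0" and \<tau>: "\<tau> > 0" and diag: "\<And>i. i < n \<Longrightarrow> A $$ (i,i) = 0"
  defines "Q \<equiv> semicircle_defect s A \<tau>" and "R \<equiv> resolvent A \<tau>"
  shows "of_nat n * (cnj Q * Q)
    = (\<Sum>i<n. \<Sum>j\<in>{..<n} - {i}. of_real (A $$ (i,j)) * defect_entry s \<tau> i j A
          - of_real m * defect_entry s \<tau> i j A + of_real s * defect_slope s \<tau> i j A)
      + (of_real m * (cnj Q * ((\<Sum>i<n. \<Sum>j<n. R i j) - (\<Sum>i<n. R i i)))
      + of_real s * (cnj Q * (2 * (\<Sum>i<n. R i i * R i i) - (\<Sum>i<n. \<Sum>j<n. R i j * R i j))))"
proof -
  let ?S = "\<Sum>i<n. R i i"
  define f where "f i j = of_real (A $$ (i,j)) * R j i - of_real m * R i j + of_real s * (R i i * R j j + R i j * R i j)" for i j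
  have Rc: "R j i = R i j" for i j unfolding R_def by (rule resolvent_commute)
  have "(\<Sum>i<n. \<Sum>j<n. f i j)
    = (\<Sum>i<n. \<Sum>j<n. of_real (A $$ (i,j)) * R j i) - of_real m * (\<Sum>i<n. \<Sum>j<n. R i j)
      + of_real s * ((\<Sum>i<n. \<Sum>j<n. R i i * R j j) + (\<Sum>i<n. \<Sum>j<n. R i j * R i j))"
    unfolding f_def by (simp only: sum.distrib sum_subtractf sum_distrib_left[symmetric])
  also have "(\<Sum>i<n. \<Sum>j<n. of_real (A $$ (i,j)) * R j i) = of_nat n + \<i> * of_real \<tau> * ?S"
    unfolding R_def trace_product[OF \<tau>] resolvent_trace_def dim ..
  also have "(\<Sum>i<n. \<Sum>j<n. R i i * R j j) = ?S * ?S" by (rule sum_product[symmetric])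
  finally have full: "(\<Sum>i<n. \<Sum>j<n. f i j) = of_nat n + \<i> * of_real \<tau> * ?S - of_real m * (\<Sum>i<n. \<Sum>j<n. R i j)
      + of_real s * (?S * ?S + (\<Sum>i<n. \<Sum>j<n. R i j * R i j))" .
  \<comment> \<open>On the diagonal the two products in the slope coincide, hence the factor
    2.\<close>
  have "(\<Sum>i<n. f i i) = (\<Sum>i<n. of_real s * (2 * (R i i * R i i)) - of_real m * R i i)"
    by (intro sum.cong refl) (simp add: f_def diag)
  also have "\<dots> = of_real s * (2 * (\<Sum>i<n. R i i * R i i)) - of_real m * ?S"
    by (simp only: sum_subtractf sum_distrib_left)
  finally have dg: "(\<Sum>i<n. f i i) = \<dots>" .
  have Qn: "of_nat n * Q = of_nat n + \<i> * of_real \<tau> * ?S + of_real s * (?S * ?S)"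
    using n unfolding Q_def semicircle_defect_def dim resolvent_trace_def R_def[symmetric]
    by (simp add: field_simps power2_eq_square)
  have "(\<Sum>i<n. \<Sum>j\<in>{..<n} - {i}. of_real (A $$ (i,j)) * defect_entry s \<tau> i j A
          - of_real m * defect_entry s \<tau> i j A + of_real s * defect_slope s \<tau> i j A)
     = (\<Sum>i<n. \<Sum>j\<in>{..<n} - {i}. cnj Q * f i j)"
    by (intro sum.cong refl)
      (simp add: defect_entry_def defect_slope_def f_def Q_def[symmetric] R_def[symmetric] Rc[of i j for i j] algebra_simps power2_eq_square)
  also have "\<dots> = (\<Sum>i<n. cnj Q * ((\<Sum>j<n. f i j) - f i i))"
    by (intro sum.cong refl) (simp only: sum_distrib_left[symmetric], simp add: sum_diff1)
  also have "\<dots> = cnj Q * ((\<Sum>i<n. \<Sum>j<n. f i j) - (\<Sum>i<n. f i i))"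
    by (simp only: sum_distrib_left[symmetric] sum_subtractf)
  finally have off: "(\<Sum>i<n. \<Sum>j\<in>{..<n} - {i}. of_real (A $$ (i,j)) * defect_entry s \<tau> i j A
          - of_real m * defect_entry s \<tau> i j A + of_real s * defect_slope s \<tau> i j A) = \<dots>" .
  have "of_nat n * (cnj Q * Q) = cnj Q * (of_nat n * Q)" by simp
  then show ?thesis unfolding off full dg Qn by (simp only: ring_distribs) simp
qed

text \<open>The sum of all entries and the trace are at most n / \<tau>, and both sums of squares at
  most n / \<tau>^2. At \<tau> = t n^(1/2) the whole is n * O(n^(-1/2)), which vanishes after
  division by n.\<close>

lemma (in symmetric_mat) offdiagonal_remainder:
  fixes m s \<tau> :: real
  assumes n: "n > 0" and \<tau>: "\<tau> > 0" and s: "0 \<le> s" "s \<le> 1" and m: "\<bar>m\<bar> \<le> 1"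
  defines "Q \<equiv> semicircle_defect s A \<tau>" and "R \<equiv> resolvent A \<tau>"
  shows "cmod (of_real m * (cnj Q * ((\<Sum>i<n. \<Sum>j<n. R i j) - (\<Sum>i<n. R i i)))
      + of_real s * (cnj Q * (2 * (\<Sum>i<n. R i i * R i i) - (\<Sum>i<n. \<Sum>j<n. R i j * R i j))))
    \<le> n * ((2 + n / \<tau>\<^sup>2) * (2 / \<tau> + 3 / \<tau>\<^sup>2))"
proof -
  define K where "K = 2 + n / \<tau>\<^sup>2"
  have Q: "cmod (cnj Q) \<le> K"
    unfolding K_def Q_def complex_mod_cnj by (rule semicircle_defect_bound[OF n \<tau> s])
  have Rsum: "cmod (\<Sum>i<n. \<Sum>j<n. R i j) \<le> n / \<tau>" unfolding R_def by (rule resolvent_sum_bound[OF \<tau>])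
  have tr: "cmod (- (\<Sum>i<n. R i i)) \<le> n / \<tau>"
    using resolvent_trace_bound[OF \<tau>] unfolding R_def resolvent_trace_def dim norm_minus_cancel .
  have "cmod (\<Sum>i<n. R i i * R i i) \<le> (\<Sum>i<n. 1 / \<tau> * (1 / \<tau>))"
    unfolding R_def by (intro sum_norm_le cmod_mult_le resolvent_bound[OF \<tau>]) auto
  then have sq: "cmod (\<Sum>i<n. R i i * R i i) \<le> n / \<tau>\<^sup>2" by (simp add: power2_eq_square)
  have "cmod (- (\<Sum>i<n. \<Sum>j<n. R i j * R i j)) \<le> (\<Sum>i<n. \<Sum>j<n. (cmod (R i j))\<^sup>2)"
    unfolding norm_minus_cancel by (intro sum_norm_le) (simp add: norm_mult power2_eq_square)
  also have "\<dots> \<le> (\<Sum>i<n. 1 / \<tau>\<^sup>2)"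
    unfolding R_def by (intro sum_mono resolvent_row_bound[OF \<tau>]) auto
  finally have hs: "cmod (- (\<Sum>i<n. \<Sum>j<n. R i j * R i j)) \<le> n / \<tau>\<^sup>2" by simp
  have ms: "cmod (of_real m) \<le> 1" "cmod (of_real s) \<le> 1" using m s by auto
  have two: "cmod 2 \<le> 2" by simp
  have "cmod (of_real m * (cnj Q * ((\<Sum>i<n. \<Sum>j<n. R i j) + - (\<Sum>i<n. R i i)))
      + of_real s * (cnj Q * (2 * (\<Sum>i<n. R i i * R i i) + - (\<Sum>i<n. \<Sum>j<n. R i j * R i j))))
    \<le> 1 * (K * (n / \<tau> + n / \<tau>)) + 1 * (K * (2 * (n / \<tau>\<^sup>2) + n / \<tau>\<^sup>2))"
    by (intro cmod_add_le cmod_mult_le Q Rsum tr sq hs ms two)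
  also have "\<dots> = n * (K * (2 / \<tau> + 3 / \<tau>\<^sup>2))"
    by (simp add: algebra_simps)
  finally show ?thesis unfolding K_def by (simp only: diff_conv_add_uminus)
qed

text \<open>The decomposition is averaged: each of at most n^2 ordered pairs contributes at most one
  resampling error, the remainder is bounded deterministically, and the result is divided by
  n.\<close>

lemma expectation_defect_square:
  fixes p q \<tau> :: real
  assumes pq: "p \<ge> 0" "q \<ge> 0" "p + q \<le> 1" and n: "n > 0" and \<tau>: "\<tau> > 0"
  defines "s \<equiv> p + q - (p - q)\<^sup>2"
  shows "measure_pmf.expectation (random_signed_graph n p q)
      (\<lambda>G. (cmod (semicircle_defect s (signed_adjacency n G) \<tau>))\<^sup>2)
    \<le> n * resample_error n \<tau> + (2 + n / \<tau>\<^sup>2) * (2 / \<tau> + 3 / \<tau>\<^sup>2)"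
proof -
  let ?E = "measure_pmf.expectation (random_signed_graph n p q) :: (signed_graph \<Rightarrow> complex) \<Rightarrow> complex"
  let ?A = "signed_adjacency n" and ?m = "p - q"
  let ?Q = "\<lambda>G. semicircle_defect s (?A G) \<tau>" and ?R = "\<lambda>G. resolvent (?A G) \<tau>"
  have m: "\<bar>?m\<bar> \<le> 1" using pq by auto
  have s1: "s \<le> 1" using pq zero_le_power2[of "p - q"] unfolding s_def by linarith
  have "s = p * (1 - ?m) + q * (1 + ?m)" by (simp add: s_def algebra_simps power2_eq_square)
  then have s0: "s \<ge> 0" using m pq by auto
  define z where "z i j = (\<lambda>G. let A = ?A G in of_real (A $$ (i,j)) * defect_entry s \<tau> i j A
      - of_real ?m * defect_entry s \<tau> i j A + of_real s * defect_slope s \<tau> i j A)" for i j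
  define W where "W G = of_real ?m * (cnj (?Q G) * ((\<Sum>i<n. \<Sum>j<n. ?R G i j) - (\<Sum>i<n. ?R G i i)))
      + of_real s * (cnj (?Q G) * (2 * (\<Sum>i<n. ?R G i i * ?R G i i) - (\<Sum>i<n. \<Sum>j<n. ?R G i j * ?R G i j)))" for G
  \<comment> \<open>The zero diagonal holds only for genuine signed graphs, hence the restriction to
    the support; the integrals below are compared almost everywhere for the same reason.\<close>
  have dec: "of_nat n * of_real ((cmod (?Q G))\<^sup>2) = (\<Sum>i<n. \<Sum>j\<in>{..<n} - {i}. z i j G) + W G"
    if "G \<in> set_pmf (random_signed_graph n p q)" for G
    unfolding complex_norm_square mult.commute[of "?Q G"] W_def z_def Let_def
    by (rule symmetric_mat.offdiagonal_decomposition[OF symmetric_mat_signed_adjacency n \<tau>])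
      (rule signed_adjacency_diagonal[OF is_signed_graph_random_signed_graph[OF that]])
  have zb: "cmod (?E (z i j)) \<le> resample_error n \<tau>" if "i < n" "j \<in> {..<n} - {i}" for i j
  proof (rule cmod_expectation_resample_le[OF pq, of "{i,j}"])
    show "{i,j} \<in> vertex_pairs n" using that by (auto simp: vertex_pairs_def)
    show "cmod (resample p q {i,j} (z i j) G) \<le> resample_error n \<tau>" for G
      unfolding z_def s_def by (rule resample_defect[OF pq _ _ _ \<tau>]) (use that in auto)
  qed
  have Wb: "cmod (?E W) \<le> n * ((2 + n / \<tau>\<^sup>2) * (2 / \<tau> + 3 / \<tau>\<^sup>2))"
    unfolding W_def
    by (intro cmod_expectation_le symmetric_mat.offdiagonal_remainder symmetric_mat_signed_adjacency n \<tau> s0 s1 m)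
  have "of_real (n * measure_pmf.expectation (random_signed_graph n p q) (\<lambda>G. (cmod (?Q G))\<^sup>2))
    = ?E (\<lambda>G. of_nat n * of_real ((cmod (?Q G))\<^sup>2))"
    by (simp only: integral_mult_right_zero integral_complex_of_real of_real_mult of_real_of_nat_eq)
  also have "\<dots> = ?E (\<lambda>G. (\<Sum>i<n. \<Sum>j\<in>{..<n} - {i}. z i j G) + W G)"
  proof (rule integral_cong_AE)
    show "AE G in measure_pmf (random_signed_graph n p q). of_nat n * of_real ((cmod (?Q G))\<^sup>2)
        = (\<Sum>i<n. \<Sum>j\<in>{..<n} - {i}. z i j G) + W G"
      unfolding AE_measure_pmf_iff by (intro ballI dec)
  qed simp_all
  also have "\<dots> = (\<Sum>i<n. \<Sum>j\<in>{..<n} - {i}. ?E (z i j)) + ?E W"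
    by simp
  finally have eq: "of_real (n * measure_pmf.expectation (random_signed_graph n p q) (\<lambda>G. (cmod (?Q G))\<^sup>2))
    = (\<Sum>i<n. \<Sum>j\<in>{..<n} - {i}. ?E (z i j)) + ?E W" .
  have err: "resample_error n \<tau> \<ge> 0" using \<tau> by (simp add: resample_error_def)
  have nn: "measure_pmf.expectation (random_signed_graph n p q) (\<lambda>G. (cmod (?Q G))\<^sup>2) \<ge> 0"
    by (rule integral_nonneg_AE) simp
  have "n * measure_pmf.expectation (random_signed_graph n p q) (\<lambda>G. (cmod (?Q G))\<^sup>2)
    = cmod ((\<Sum>i<n. \<Sum>j\<in>{..<n} - {i}. ?E (z i j)) + ?E W)"
    unfolding eq[symmetric] norm_of_real using nn by simp
  also have "\<dots> \<le> (\<Sum>i<n. \<Sum>j\<in>{..<n} - {i}. resample_error n \<tau>) + n * ((2 + n / \<tau>\<^sup>2) * (2 / \<tau> + 3 / \<tau>\<^sup>2))"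
    by (intro cmod_add_le sum_norm_le zb Wb) auto
  also have "(\<Sum>i<n. \<Sum>j\<in>{..<n} - {i}. resample_error n \<tau>) \<le> (\<Sum>i<n. \<Sum>j<n. resample_error n \<tau>)"
    by (intro sum_mono sum_mono2) (use err in auto)
  finally have "n * measure_pmf.expectation (random_signed_graph n p q) (\<lambda>G. (cmod (?Q G))\<^sup>2)
    \<le> n * (n * resample_error n \<tau> + (2 + n / \<tau>\<^sup>2) * (2 / \<tau> + 3 / \<tau>\<^sup>2))"
    by (simp add: algebra_simps)
  then show ?thesis using n by simp
qed

section \<open>Semicircle integrals\<close>

lemma has_bochner_integral_FTC_atLeast:
  fixes f F :: "real \<Rightarrow> real"
  assumes borel: "f \<in> borel_measurable borel"
    and deriv: "\<And>x. a \<le> x \<Longrightarrow> DERIV F x :> f x" and nonneg: "\<And>x. a \<le> x \<Longrightarrow> 0 \<le> f x"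
    and lim: "(F \<longlongrightarrow> T) at_top"
  shows "has_bochner_integral lborel (\<lambda>x. f x * indicator {a..} x) (T - F a)"
proof (rule has_bochner_integral_nn_integral)
  show "(\<lambda>x. f x * indicator {a..} x) \<in> borel_measurable lborel" using borel by simp
  show "AE x in lborel. 0 \<le> f x * indicator {a..} x"
    using nonneg by (auto simp: indicator_def)
  have "(\<integral>\<^sup>+x. ennreal (f x * indicator {a..} x) \<partial>lborel) = (\<integral>\<^sup>+x. ennreal (f x) * indicator {a..} x \<partial>lborel)"
    by (intro nn_integral_cong) (auto simp: indicator_def)
  then show "(\<integral>\<^sup>+x. ennreal (f x * indicator {a..} x) \<partial>lborel) = ennreal (T - F a)"
    using nn_integral_FTC_atLeast[OF borel deriv nonneg lim] by simp
  \<comment> \<open>\<open>ennreal\<close> truncates negative numbers to 0, so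
    \<open>T - F a\<close> must be known to be nonnegative.\<close>
  have "F a \<le> F x" if "a \<le> x" for x
    by (rule DERIV_nonneg_imp_nondecreasing[OF that]) (use deriv nonneg in blast)
  then have "F a \<le> T"
    by (intro tendsto_lowerbound[OF lim]) (auto intro: eventually_mono[OF eventually_ge_at_top[of a]])
  then show "0 \<le> T - F a" by simp
qed

text \<open>For y = |x| > 0 an antiderivative is y arctan (t / y). For x = 0 the integrand vanishes,
  also at t = 0, where 0 / 0 is 0.\<close>

lemma has_bochner_integral_abs:
  fixes x :: real
  shows "has_bochner_integral lborel (\<lambda>t. x\<^sup>2 / (x\<^sup>2 + t\<^sup>2) * indicator {0..} t) (\<bar>x\<bar> * pi / 2)"
proof (cases "x = 0")
  case False
  define y where "y = \<bar>x\<bar>"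
  have y: "y > 0" "x\<^sup>2 = y\<^sup>2" using False by (auto simp: y_def)
  have "has_bochner_integral lborel (\<lambda>t. y\<^sup>2 / (y\<^sup>2 + t\<^sup>2) * indicator {0..} t) (y * (pi / 2) - y * arctan (0 / y))"
  proof (rule has_bochner_integral_FTC_atLeast)
    fix t :: real
    show "((\<lambda>t. y * arctan (t / y)) has_real_derivative y\<^sup>2 / (y\<^sup>2 + t\<^sup>2)) (at t)"
    proof -
      have "1 + (t / y)\<^sup>2 = (y\<^sup>2 + t\<^sup>2) / y\<^sup>2" using y(1) by (simp add: power_divide add_divide_distrib)
      then have "y * (inverse (1 + (t / y)\<^sup>2) * (1 / y)) = y\<^sup>2 / (y\<^sup>2 + t\<^sup>2)" using y(1) by simp
      moreover have "((\<lambda>t. y * arctan (t / y)) has_real_derivative y * (inverse (1 + (t / y)\<^sup>2) * (1 / y))) (at t)"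
        by (intro DERIV_cmult DERIV_chain2[OF DERIV_arctan] DERIV_cdivide DERIV_ident)
      ultimately show ?thesis by simp
    qed
    show "((\<lambda>t. y * arctan (t / y)) \<longlongrightarrow> y * (pi / 2)) at_top"
    proof -
      have "filterlim (\<lambda>t. t / y) at_top at_top" using y(1) by real_asymp
      then show ?thesis by (rule tendsto_mult[OF tendsto_const filterlim_compose[OF tendsto_arctan_at_top]])
    qed
  qed auto
  then show ?thesis by (simp add: y_def)
qed (simp add: has_bochner_integral_zero)

text \<open>The nonnegative root w of s w^2 + t w = 1 for t > 0, that is, the value at i t of the
  Stieltjes transform of the semicircle law divided by i. The rationalised form also covers s = 0,
  where w = 1 / t.\<close>

definition semicircle_stieltjes :: "real \<Rightarrow> real \<Rightarrow> real" where
  "semicircle_stieltjes s t = 2 / (t + sqrt (t\<^sup>2 + 4 * s))"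

lemma semicircle_stieltjes_eq:
  assumes "s \<ge> 0" "t > 0"
  shows "1 - t * semicircle_stieltjes s t = s * (semicircle_stieltjes s t)\<^sup>2"
proof -
  define r where "r = sqrt (t\<^sup>2 + 4 * s)"
  have r: "r \<ge> 0" "r\<^sup>2 = t\<^sup>2 + 4 * s" using assms by (auto simp: r_def)
  have w: "semicircle_stieltjes s t = 2 / (t + r)" by (simp add: semicircle_stieltjes_def r_def)
  have pos: "t + r > 0" using r assms by simp
  have e: "4 * s = (r - t) * (t + r)" using r by (simp add: algebra_simps power2_eq_square)
  have "1 - t * (2 / (t + r)) = (r - t) / (t + r)" using pos by (simp add: field_simps)
  moreover have "s * (2 / (t + r))\<^sup>2 = (4 * s) / ((t + r) * (t + r))" by (simp add: power2_eq_square)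
  ultimately show ?thesis unfolding w e using pos by simp
qed

text \<open>Adds s w^2 = 1 - t w \<le> 1 and t^2 s w^2 = s (t w)^2 \<le> 1. The majorant is the one
  that \<open>spectral_tail\<close> obeys.\<close>

lemma semicircle_stieltjes_bounds:
  assumes "0 \<le> s" "s \<le> 1" "t > 0"
  shows "semicircle_stieltjes s t \<ge> 0" "s * (semicircle_stieltjes s t)\<^sup>2 \<le> 2 / (1 + t\<^sup>2)"
proof -
  let ?w = "semicircle_stieltjes s t"
  have r: "sqrt (t\<^sup>2 + 4 * s) \<ge> t" using assms by (intro real_le_rsqrt) auto
  show w: "?w \<ge> 0" using assms unfolding semicircle_stieltjes_def by auto
  have "?w \<le> 2 / (2 * t)"
    unfolding semicircle_stieltjes_def using r assms by (intro divide_left_mono mult_pos_pos) auto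
  then have tw: "t * ?w \<le> 1" using assms by (simp add: field_simps)
  have 1: "s * ?w\<^sup>2 \<le> 1" using semicircle_stieltjes_eq[of s t] w assms by (smt (verit) mult_nonneg_nonneg)
  have "t\<^sup>2 * (s * ?w\<^sup>2) = s * (t * ?w)\<^sup>2" by (simp add: power_mult_distrib)
  also have "\<dots> \<le> 1 * 1\<^sup>2" using tw w assms by (intro mult_mono power_mono) auto
  finally have "(1 + t\<^sup>2) * (s * ?w\<^sup>2) \<le> 2" using 1 by (simp add: distrib_right)
  then show "s * ?w\<^sup>2 \<le> 2 / (1 + t\<^sup>2)" by (simp add: field_simps pos_le_divide_eq add_pos_nonneg)
qed

text \<open>The antiderivative comes from using w as variable: t = 1 / w - s w turns s w^2 dt into
  -(s + s^2 w^2) dw. As t runs from 0 to infinity, w falls from 1 / sqrt s to 0, which gives sqrt s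
  + sqrt s / 3.\<close>

lemma has_bochner_integral_semicircle:
  assumes "s \<ge> 0"
  shows "has_bochner_integral lborel (\<lambda>t. s * (semicircle_stieltjes s t)\<^sup>2 * indicator {0..} t) (4 / 3 * sqrt s)"
proof (cases "s = 0")
  case False
  with assms have s: "s > 0" by simp
  let ?w = "semicircle_stieltjes s"
  let ?F = "\<lambda>t. - (s * ?w t + s\<^sup>2 * (?w t) ^ 3 / 3)"
  have "has_bochner_integral lborel (\<lambda>t. s * (?w t)\<^sup>2 * indicator {0..} t) (0 - ?F 0)"
  proof (rule has_bochner_integral_FTC_atLeast)
    show "(\<lambda>t. s * (?w t)\<^sup>2) \<in> borel_measurable borel"
      unfolding semicircle_stieltjes_def by measurable
    show "0 \<le> s * (?w t)\<^sup>2" for t using s by simp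
    show "(?F \<longlongrightarrow> 0) at_top"
      unfolding semicircle_stieltjes_def using s by real_asymp
    fix t :: real assume t: "0 \<le> t"
    define r where "r = sqrt (t\<^sup>2 + 4 * s)"
    have pos: "t\<^sup>2 + 4 * s > 0" using s by (simp add: add_nonneg_pos)
    then have r: "r > 0" by (simp add: r_def)
    have w: "?w t = 2 / (t + r)" by (simp add: semicircle_stieltjes_def r_def)
    have "((\<lambda>t. sqrt (t\<^sup>2 + 4 * s)) has_real_derivative t / r) (at t)"
      using pos by (auto intro!: derivative_eq_intros simp: r_def field_simps)
    then have "((\<lambda>t. t + sqrt (t\<^sup>2 + 4 * s)) has_real_derivative 1 + t / r) (at t)"
      by (intro DERIV_add DERIV_ident)
    then have "(?w has_real_derivative (0 * (t + sqrt (t\<^sup>2 + 4 * s)) - 2 * (1 + t / r))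
        / ((t + sqrt (t\<^sup>2 + 4 * s)) * (t + sqrt (t\<^sup>2 + 4 * s)))) (at t)"
      unfolding semicircle_stieltjes_def[abs_def]
      by (intro DERIV_divide DERIV_const) (use t r in \<open>simp_all add: r_def[symmetric]\<close>)
    then have "(?w has_real_derivative (0 * (t + r) - 2 * (1 + t / r)) / ((t + r) * (t + r))) (at t)"
      by (simp only: r_def)
    moreover have "(0 * (t + r) - 2 * (1 + t / r)) / ((t + r) * (t + r)) = - (?w t / r)"
    proof -
      have "t + r > 0" using t r by simp
      then show ?thesis unfolding w using r by (simp add: divide_simps)
    qed
    ultimately have "(?w has_real_derivative - (?w t / r)) (at t)" by simp
    then have "(?F has_real_derivative - (s * (- (?w t / r)) + s\<^sup>2 * (3 * (?w t)\<^sup>2 * (- (?w t / r))) / 3)) (at t)"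
      by (auto intro!: derivative_eq_intros simp: mult_ac add.commute)
    moreover have "- (s * (- (?w t / r)) + s\<^sup>2 * (3 * (?w t)\<^sup>2 * (- (?w t / r))) / 3) = s * (?w t)\<^sup>2"
    proof -
      have "r\<^sup>2 = t\<^sup>2 + 4 * s" using pos by (simp add: r_def)
      then have "4 * s = (r - t) * (t + r)" by (simp add: algebra_simps power2_eq_square)
      moreover have "s * (2 / (t + r))\<^sup>2 = (4 * s) / ((t + r) * (t + r))" by (simp add: power2_eq_square)
      \<comment> \<open>The quadratic equation of w in terms of r; together with w' = - w / r it
        collapses the derivative to s w^2.\<close>
      ultimately have "s * (2 / (t + r))\<^sup>2 = (r - t) / (t + r)" using t r by simp
      then have e: "1 + s * (?w t)\<^sup>2 = r * ?w t"
        unfolding w using t r by (simp add: field_simps)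
      have "- (s * (- (?w t / r)) + s\<^sup>2 * (3 * (?w t)\<^sup>2 * (- (?w t / r))) / 3) = s * ?w t / r * (1 + s * (?w t)\<^sup>2)"
        by (simp add: algebra_simps power2_eq_square)
      then show ?thesis unfolding e using r by (simp add: power2_eq_square)
    qed
    ultimately show "(?F has_real_derivative s * (?w t)\<^sup>2) (at t)" by simp
  qed
  moreover have "0 - ?F 0 = 4 / 3 * sqrt s"
  proof -
    have w0: "?w 0 = 1 / sqrt s" using s by (simp add: semicircle_stieltjes_def real_sqrt_mult)
    have "s * (1 / sqrt s) = sqrt s" using s by (simp add: real_div_sqrt)
    moreover have "s\<^sup>2 * (1 / sqrt s) ^ 3 = (s * (1 / sqrt s)) * (s * (1 / sqrt s)\<^sup>2)"
      by (simp only: power2_eq_square power3_eq_cube mult_ac)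
    moreover have "s * (1 / sqrt s)\<^sup>2 = 1" using s by (simp add: power_divide)
    ultimately show ?thesis unfolding w0 by simp
  qed
  ultimately show ?thesis by (simp only:)
qed (simp add: has_bochner_integral_zero)

text \<open>Im Q = Re z * (t + 2 s Im z) controls Re z, and subtracting the equation of w from Re Q
  gives (t + s (Im z + w)) (Im z - w) = s (Re z)^2 - Re Q. The condition Im z \<ge> 0 keeps both
  coefficients at least t, away from the other root.\<close>

lemma semicircle_stability:
  fixes z :: complex
  assumes t: "t > 0" and s: "s \<ge> 0" and z: "cmod z \<le> 1 / t" and im: "Im z \<ge> 0"
    and w: "w \<ge> 0" "1 - t * w = s * w\<^sup>2"
  shows "t * \<bar>Im z - w\<bar> \<le> (1 + s / t\<^sup>2) * cmod (1 + \<i> * of_real t * z + of_real s * z\<^sup>2)"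
proof -
  let ?a = "Re z" and ?b = "Im z" and ?Q = "1 + \<i> * of_real t * z + of_real s * z\<^sup>2"
  have re: "Re ?Q = 1 - t * ?b + s * (?a\<^sup>2 - ?b\<^sup>2)" and imq: "Im ?Q = ?a * (t + 2 * s * ?b)"
    by (simp_all add: Re_power2 Im_power2 algebra_simps)
  have "\<bar>?a\<bar> * t \<le> \<bar>?a\<bar> * (t + 2 * s * ?b)" using s im by (intro mult_left_mono) auto
  also have "\<dots> = \<bar>Im ?Q\<bar>" unfolding imq abs_mult using t s im by simp
  also have "\<dots> \<le> cmod ?Q" by (rule abs_Im_le_cmod)
  finally have a: "\<bar>?a\<bar> \<le> cmod ?Q / t" using t by (simp add: field_simps)
  have "?a\<^sup>2 = \<bar>?a\<bar> * \<bar>?a\<bar>" by (simp add: power2_eq_square)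
  also have "\<dots> \<le> (cmod ?Q / t) * (1 / t)"
    using a z abs_Re_le_cmod[of z] t by (intro mult_mono) auto
  finally have a2: "s * ?a\<^sup>2 \<le> s * (cmod ?Q / t\<^sup>2)"
    using s by (intro mult_left_mono) (auto simp: power2_eq_square)
  have "t * \<bar>?b - w\<bar> \<le> (t + s * (?b + w)) * \<bar>?b - w\<bar>"
    using s im w by (intro mult_right_mono) auto
  also have "\<dots> = \<bar>(t + s * (?b + w)) * (?b - w)\<bar>"
    unfolding abs_mult using t s im w by simp
  also have "(t + s * (?b + w)) * (?b - w) = (1 - t * w - s * w\<^sup>2) - (1 - t * ?b - s * ?b\<^sup>2)"
    by (simp add: algebra_simps power2_eq_square)
  also have "\<dots> = s * ?a\<^sup>2 - Re ?Q" unfolding re using w by (simp add: algebra_simps)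
  also have "\<bar>\<dots>\<bar> \<le> s * ?a\<^sup>2 + cmod ?Q"
    using abs_triangle_ineq4[of "s * ?a\<^sup>2" "Re ?Q"] abs_Re_le_cmod[of ?Q] s by simp
  also have "\<dots> \<le> s * (cmod ?Q / t\<^sup>2) + cmod ?Q" using a2 by simp
  finally show ?thesis by (simp add: algebra_simps)
qed

section \<open>Convergence of the energy\<close>

text \<open>The mean of x^2 / (x^2 + t^2) over the eigenvalues x of A / n^(1/2), with numerator and
  denominator multiplied by n.\<close>

definition spectral_tail :: "real mat \<Rightarrow> real \<Rightarrow> real" where
  "spectral_tail A t = (\<Sum>k<dim_row A. (eigval A k)\<^sup>2 / ((eigval A k)\<^sup>2 + real (dim_row A) * t\<^sup>2)) / real (dim_row A)"

context symmetric_mat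
begin

text \<open>In the power n^(-3/2), n^(-1/2) is the scaling of the eigenvalues and n^(-1) the
  averaging over them.\<close>

lemma has_bochner_integral_spectral_tail:
  assumes n: "n > 0"
  shows "has_bochner_integral lborel (\<lambda>t. spectral_tail A t * indicator {0..} t)
    (pi / 2 * (n powr (-3/2) * energy A))"
proof -
  have eq: "(eigval A k / sqrt n)\<^sup>2 / ((eigval A k / sqrt n)\<^sup>2 + t\<^sup>2) = (eigval A k)\<^sup>2 / ((eigval A k)\<^sup>2 + n * t\<^sup>2)" for k and t :: real
  proof -
    have "(eigval A k / sqrt n)\<^sup>2 + t\<^sup>2 = ((eigval A k)\<^sup>2 + n * t\<^sup>2) / n"
      using n by (simp add: power_divide add_divide_distrib)
    then show ?thesis using n by (simp add: power_divide)
  qed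
  have "has_bochner_integral lborel (\<lambda>t. (\<Sum>k<n. (eigval A k / sqrt n)\<^sup>2 / ((eigval A k / sqrt n)\<^sup>2 + t\<^sup>2) * indicator {0..} t) / n)
    ((\<Sum>k<n. \<bar>eigval A k / sqrt n\<bar> * pi / 2) / n)"
    by (intro has_bochner_integral_divide_zero has_bochner_integral_sum has_bochner_integral_abs)
  moreover have "(\<Sum>k<n. (eigval A k / sqrt n)\<^sup>2 / ((eigval A k / sqrt n)\<^sup>2 + t\<^sup>2) * indicator {0..} t) / n
     = spectral_tail A t * indicator {0..} t" for t
    unfolding spectral_tail_def dim sum_distrib_right[symmetric] eq by simp
  moreover have "(\<Sum>k<n. \<bar>eigval A k / sqrt n\<bar> * pi / 2) / n = pi / 2 * (n powr (-3/2) * energy A)"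
  proof -
    have "n powr (3/2) = n powr (1 + 1/2)" by simp
    also have "\<dots> = n * sqrt n" unfolding powr_add using n by (simp add: powr_half_sqrt)
    finally have p: "n powr (-3/2) = 1 / (n * sqrt n)" by (simp add: powr_minus_divide)
    have "(\<Sum>k<n. \<bar>eigval A k / sqrt n\<bar> * pi / 2) = energy A * (pi / (2 * sqrt n))"
      unfolding energy_eq sum_distrib_right by (intro sum.cong refl) (simp add: abs_divide)
    then show ?thesis unfolding p by (simp only:) (simp add: mult_ac)
  qed
  ultimately show ?thesis by (simp only:)
qed

text \<open>Each summand is at most 1, and t^2 times it at most \<lambda>^2 / n; the squares of the
  eigenvalues sum to at most n^2. The majorant depends neither on n nor on the matrix.\<close>

lemma spectral_tail_bounds:
  assumes n: "n > 0" and entries: "\<And>i j. i < n \<Longrightarrow> j < n \<Longrightarrow> \<bar>A $$ (i,j)\<bar> \<le> 1"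
  shows "0 \<le> spectral_tail A t" "spectral_tail A t \<le> 2 / (1 + t\<^sup>2)"
proof -
  let ?l = "\<lambda>k. (eigval A k)\<^sup>2" and ?N = "real n"
  show "0 \<le> spectral_tail A t" by (simp add: spectral_tail_def sum_nonneg)
  have "(\<Sum>k<n. ?l k / (?l k + ?N * t\<^sup>2)) \<le> (\<Sum>k<n. 1)"
  proof (rule sum_mono)
    fix k
    show "?l k / (?l k + ?N * t\<^sup>2) \<le> 1"
    \<comment> \<open>The denominator is 0 when t = 0 meets a zero eigenvalue; the quotient is then
      0 by convention.\<close>
    proof (cases "?l k + ?N * t\<^sup>2 = 0")
      case False
      have "?l k / (?l k + ?N * t\<^sup>2) \<le> (?l k + ?N * t\<^sup>2) / (?l k + ?N * t\<^sup>2)"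
        by (rule divide_right_mono) auto
      also have "\<dots> = 1" by (rule divide_self[OF False])
      finally show ?thesis .
    qed (simp only: div_by_0 zero_le_one)
  qed
  then have 1: "spectral_tail A t \<le> 1" using n by (simp add: spectral_tail_def divide_le_eq)
  have "(\<Sum>k<n. ?l k / (?l k + ?N * t\<^sup>2)) * t\<^sup>2 \<le> (\<Sum>k<n. ?l k / ?N)"
    unfolding sum_distrib_right
  proof (intro sum_mono)
    fix k
    show "?l k / (?l k + ?N * t\<^sup>2) * t\<^sup>2 \<le> ?l k / ?N"
    proof (cases "?l k + ?N * t\<^sup>2 = 0")
      case False
      have "0 \<le> ?l k + ?N * t\<^sup>2" by simp
      then have pos: "0 < ?l k + ?N * t\<^sup>2" by (rule order.not_eq_order_implies_strict[OF False[symmetric]])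
      have "?l k * (?N * t\<^sup>2) \<le> ?l k * (?l k + ?N * t\<^sup>2)" by (intro mult_left_mono) auto
      then show ?thesis using pos n by (simp add: divide_simps mult_ac)
    qed simp
  qed
  also have "\<dots> = (\<Sum>i<n. \<Sum>j<n. (A $$ (i,j))\<^sup>2) / ?N"
    unfolding sum_eigval_squares[symmetric] by (simp add: sum_divide_distrib)
  also have "\<dots> \<le> (\<Sum>i<n. \<Sum>j<n. 1) / ?N"
    using entries by (intro divide_right_mono sum_mono) (auto simp: abs_square_le_1)
  also have "\<dots> = ?N" using n by simp
  finally have "spectral_tail A t * t\<^sup>2 \<le> 1" using n by (simp add: spectral_tail_def divide_le_eq)
  with 1 have "spectral_tail A t * (1 + t\<^sup>2) \<le> 2" by (simp add: distrib_left)
  then show "spectral_tail A t \<le> 2 / (1 + t\<^sup>2)" by (simp add: pos_le_divide_eq add_pos_nonneg)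
qed

text \<open>Since x^2 / (x^2 + t^2) = 1 - t * t / (x^2 + t^2), the tail is 1 - t Im z, while s w^2 =
  1 - t w. Their distance t |Im z - w| is what stability controls. The factor 1 + s / t^2 is
  unbounded near t = 0 when s > 0, so the estimate is used for fixed t only.\<close>

lemma spectral_tail_near_semicircle:
  assumes n: "n > 0" and t: "t > 0" and s: "0 \<le> s" "s \<le> 1"
  shows "\<bar>spectral_tail A t - s * (semicircle_stieltjes s t)\<^sup>2\<bar>
    \<le> (1 + s / t\<^sup>2) * cmod (semicircle_defect s A (t * sqrt n))"
proof -
  let ?w = "semicircle_stieltjes s t"
  define \<tau> where "\<tau> = t * sqrt n"
  have \<tau>: "\<tau> > 0" and \<tau>2: "\<tau>\<^sup>2 = n * t\<^sup>2" using n t by (auto simp: \<tau>_def power_mult_distrib)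
  define z where "z = resolvent_trace A \<tau> / of_real (sqrt n)"
  have sq: "complex_of_real (sqrt n) * complex_of_real (sqrt n) = of_nat n"
    by (simp flip: of_real_mult)
  have sq0: "complex_of_real (sqrt n) \<noteq> 0" using n by simp
  have "cmod z = cmod (resolvent_trace A \<tau>) / sqrt n" by (simp add: z_def norm_divide)
  also have "\<dots> \<le> (n / \<tau>) / sqrt n"
    by (rule divide_right_mono[OF resolvent_trace_bound[OF \<tau>]]) simp
  also have "\<dots> = 1 / t" using n t by (simp add: \<tau>_def mult.assoc)
  finally have z1: "cmod z \<le> 1 / t" .
  have Imz: "Im z = (\<Sum>k<n. \<tau> / ((eigval A k)\<^sup>2 + \<tau>\<^sup>2)) / sqrt n"
    unfolding z_def Im_divide_of_real Im_resolvent_trace[OF \<tau>] ..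
  then have z2: "Im z \<ge> 0" using \<tau> by (auto intro!: divide_nonneg_nonneg sum_nonneg)
  have tail: "spectral_tail A t = 1 - t * Im z"
  proof -
    have "(eigval A k)\<^sup>2 / ((eigval A k)\<^sup>2 + n * t\<^sup>2) = 1 - n * t * (\<tau> / ((eigval A k)\<^sup>2 + \<tau>\<^sup>2)) / sqrt n" for k
    proof -
      have "(eigval A k)\<^sup>2 + n * t\<^sup>2 > 0" using n t by (simp add: add_nonneg_pos)
      then have "(eigval A k)\<^sup>2 / ((eigval A k)\<^sup>2 + n * t\<^sup>2) = 1 - n * t\<^sup>2 / ((eigval A k)\<^sup>2 + n * t\<^sup>2)"
        by (simp add: field_simps)
      moreover have "n * t * (\<tau> / X) / sqrt n = n * t\<^sup>2 / X" for X
        using n by (simp add: \<tau>_def power2_eq_square)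
      ultimately show ?thesis unfolding \<tau>2 by simp
    qed
    then have "(\<Sum>k<n. (eigval A k)\<^sup>2 / ((eigval A k)\<^sup>2 + n * t\<^sup>2))
      = n - n * (t * ((\<Sum>k<n. \<tau> / ((eigval A k)\<^sup>2 + \<tau>\<^sup>2)) / sqrt n))"
      by (simp add: sum_subtractf sum_distrib_left sum_divide_distrib mult.assoc)
    then show ?thesis unfolding spectral_tail_def dim Imz using n by (simp add: field_simps)
  qed
  have defect: "semicircle_defect s A \<tau> = 1 + \<i> * of_real t * z + of_real s * z\<^sup>2"
  proof -
    have "\<i> * of_real t * z = \<i> * of_real \<tau> * resolvent_trace A \<tau> / of_nat n"
      unfolding z_def \<tau>_def sq[symmetric] using sq0 by (simp add: of_real_mult)
    moreover have "of_real s * z\<^sup>2 = of_real s * (resolvent_trace A \<tau>)\<^sup>2 / of_nat n"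
      unfolding z_def sq[symmetric] by (simp add: power2_eq_square)
    ultimately show ?thesis unfolding semicircle_defect_def dim by simp
  qed
  have "\<bar>spectral_tail A t - s * ?w\<^sup>2\<bar> = \<bar>t * (?w - Im z)\<bar>"
    unfolding tail semicircle_stieltjes_eq[OF s(1) t, symmetric] by (simp add: algebra_simps)
  also have "\<dots> = t * \<bar>Im z - ?w\<bar>" using t by (simp add: abs_mult)
  also have "\<dots> \<le> (1 + s / t\<^sup>2) * cmod (semicircle_defect s A \<tau>)"
    unfolding defect
    by (rule semicircle_stability[OF t s(1) z1 z2 semicircle_stieltjes_bounds(1)[OF s t] semicircle_stieltjes_eq[OF s(1) t]])
  finally show ?thesis unfolding \<tau>_def .
qed

end

section \<open>From fixed t to the energy\<close>

lemma signed_adjacency_entry_bound: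
  assumes "i < n" "j < n"
  shows "\<bar>signed_adjacency n G $$ (i,j)\<bar> \<le> 1"
  using assms by (auto simp: signed_adjacency_def split: option.split sign.split)

lemma defect_bound_tendsto_0:
  fixes t :: real
  assumes "t > 0"
  shows "(\<lambda>n. n * resample_error n (t * sqrt n)
    + (2 + n / (t * sqrt n)\<^sup>2) * (2 / (t * sqrt n) + 3 / (t * sqrt n)\<^sup>2)) \<longlonglongrightarrow> 0"
  unfolding resample_error_def using assms by real_asymp

lemma integrable_2_div_1_plus_square: "integrable lborel (\<lambda>t :: real. 2 / (1 + t\<^sup>2) * indicator {0..} t)"
proof -
  have "integrable lborel (\<lambda>t :: real. 1 / (1 + t\<^sup>2) * indicator {0..} t)"
    using has_bochner_integral_abs[of 1] by (simp add: has_bochner_integral_iff)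
  from integrable_mult_right[OF this, of 2] show ?thesis by simp
qed

context
  fixes p q :: real
  assumes pq: "p \<ge> 0" "q \<ge> 0" "p + q \<le> 1"
begin

abbreviation (input) "sv \<equiv> p + q - (p - q)\<^sup>2"

lemma variance_bounds: "0 \<le> sv" "sv \<le> 1"
proof -
  have "sv = p * (1 - (p - q)) + q * (1 + (p - q))" by (simp add: algebra_simps power2_eq_square)
  moreover have "0 \<le> 1 - (p - q)" "0 \<le> 1 + (p - q)" using pq by auto
  ultimately show "0 \<le> sv" using pq by simp
  show "sv \<le> 1" using pq zero_le_power2[of "p - q"] by linarith
qed

text \<open>The distance is taken in mean at each fixed t, so a deterministic function of t remains
  to be integrated.\<close>

definition mean_deviation :: "nat \<Rightarrow> real \<Rightarrow> real" where
  "mean_deviation n t = measure_pmf.expectation (random_signed_graph n p q)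
     (\<lambda>G. \<bar>spectral_tail (signed_adjacency n G) t - sv * (semicircle_stieltjes sv t)\<^sup>2\<bar>)"

lemma mean_deviation_tendsto_0:
  assumes t: "t > 0"
  shows "(\<lambda>n. mean_deviation n t) \<longlonglongrightarrow> 0"
proof (rule real_tendsto_sandwich)
  let ?B = "\<lambda>n. n * resample_error n (t * sqrt n)
    + (2 + n / (t * sqrt n)\<^sup>2) * (2 / (t * sqrt n) + 3 / (t * sqrt n)\<^sup>2)"
  let ?c = "1 + sv / t\<^sup>2"
  have c: "?c \<ge> 0" using variance_bounds by simp
  show "eventually (\<lambda>n. 0 \<le> mean_deviation n t) sequentially"
    unfolding mean_deviation_def by (intro always_eventually allI integral_nonneg_AE) simp
  show "eventually (\<lambda>n. mean_deviation n t \<le> ?c * sqrt (?B n)) sequentially"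
    using eventually_gt_at_top[of 0]
  proof eventually_elim
    case (elim n)
    let ?M = "measure_pmf (random_signed_graph n p q)" and ?Q = "\<lambda>G. cmod (semicircle_defect sv (signed_adjacency n G) (t * sqrt n))"
    have "mean_deviation n t \<le> measure_pmf.expectation (random_signed_graph n p q) (\<lambda>G. ?c * ?Q G)"
      unfolding mean_deviation_def
      by (intro integral_mono integrable_random_signed_graph
        symmetric_mat.spectral_tail_near_semicircle symmetric_mat_signed_adjacency elim t variance_bounds)
    also have "\<dots> = ?c * measure_pmf.expectation (random_signed_graph n p q) ?Q"
      by simp
    \<comment> \<open>Cauchy-Schwarz, in the form that a variance is nonnegative.\<close>
    also have "measure_pmf.expectation (random_signed_graph n p q) ?Q
      \<le> sqrt (measure_pmf.expectation (random_signed_graph n p q) (\<lambda>G. (?Q G)\<^sup>2))"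
    proof (rule real_le_rsqrt)
      have "0 \<le> measure_pmf.variance (random_signed_graph n p q) ?Q"
        by (rule integral_nonneg_AE) simp
      also have "\<dots> = measure_pmf.expectation (random_signed_graph n p q) (\<lambda>G. (?Q G)\<^sup>2)
          - (measure_pmf.expectation (random_signed_graph n p q) ?Q)\<^sup>2"
        by (rule measure_pmf.variance_eq) simp_all
      finally show "(measure_pmf.expectation (random_signed_graph n p q) ?Q)\<^sup>2
        \<le> measure_pmf.expectation (random_signed_graph n p q) (\<lambda>G. (?Q G)\<^sup>2)" by simp
    qed
    also have "\<dots> \<le> sqrt (?B n)"
      using expectation_defect_square[OF pq elim, of "t * sqrt n"] elim t by simp
    finally show ?case using c by (simp add: mult_left_mono)
  qed
  have "(\<lambda>n. ?c * sqrt (?B n)) \<longlonglongrightarrow> ?c * sqrt 0"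
    by (intro tendsto_mult tendsto_const tendsto_real_sqrt defect_bound_tendsto_0[OF t])
  then show "(\<lambda>n. ?c * sqrt (?B n)) \<longlonglongrightarrow> 0" by simp
qed simp

text \<open>Both quantities lie between 0 and the same majorant, so their distance does too, for
  every graph.\<close>

lemma deviation_bound:
  assumes n: "n > 0" and t: "t > 0"
  shows "\<bar>spectral_tail (signed_adjacency n G) t - sv * (semicircle_stieltjes sv t)\<^sup>2\<bar> \<le> 2 / (1 + t\<^sup>2)"
proof -
  interpret symmetric_mat "signed_adjacency n G" n by (rule symmetric_mat_signed_adjacency)
  have "0 \<le> sv * (semicircle_stieltjes sv t)\<^sup>2" using variance_bounds by simp
  then show ?thesis
    using spectral_tail_bounds[OF n signed_adjacency_entry_bound, of t] semicircle_stieltjes_bounds(2)[OF variance_bounds t]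
    by linarith
qed

lemma deviation_measurable [measurable]:
  "(\<lambda>t. \<bar>spectral_tail A t - sv * (semicircle_stieltjes sv t)\<^sup>2\<bar>) \<in> borel_measurable borel"
  unfolding spectral_tail_def semicircle_stieltjes_def by measurable

lemma mean_deviation_measurable [measurable]: "mean_deviation n \<in> borel_measurable borel"
proof -
  have "mean_deviation n = (\<lambda>t. \<Sum>G\<in>set_pmf (random_signed_graph n p q).
    \<bar>spectral_tail (signed_adjacency n G) t - sv * (semicircle_stieltjes sv t)\<^sup>2\<bar> * pmf (random_signed_graph n p q) G)"
    unfolding mean_deviation_def
    by (intro ext integral_measure_pmf_real finite_set_random_signed_graph) auto
  then show ?thesis by (simp only:) measurable
qed

text \<open>Dominated convergence. The point t = 0, where the resolvent estimates say nothing, is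
  dropped as a null set.\<close>

lemma integral_mean_deviation_tendsto_0:
  "(\<lambda>n. \<integral>t. mean_deviation n t * indicator {0..} t \<partial>lborel) \<longlonglongrightarrow> 0"
proof -
  \<comment> \<open>The shift to \<open>Suc n\<close> makes the number of vertices positive for
    every term, as the domination requires.\<close>
  have "(\<lambda>n. \<integral>t. mean_deviation (Suc n) t * indicator {0..} t \<partial>lborel) \<longlonglongrightarrow> (\<integral>(t::real). 0 \<partial>lborel)"
  proof (rule integral_dominated_convergence)
    show "integrable lborel (\<lambda>t :: real. 2 / (1 + t\<^sup>2) * indicator {0..} t)" by (rule integrable_2_div_1_plus_square)
    show "AE t in lborel. (\<lambda>n. mean_deviation (Suc n) t * indicator {0..} t) \<longlonglongrightarrow> 0"
      using AE_lborel_singleton[of 0]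
    proof eventually_elim
      case (elim t)
      show ?case
      proof (cases "t > 0")
        case True
        then show ?thesis using LIMSEQ_Suc[OF mean_deviation_tendsto_0[OF True]] by simp
      qed (use elim in simp)
    qed
    show "AE t in lborel. norm (mean_deviation (Suc n) t * indicator {0..} t) \<le> 2 / (1 + t\<^sup>2) * indicator {0..} t" for n
      using AE_lborel_singleton[of 0]
    proof eventually_elim
      case (elim t)
      show ?case
      proof (cases "t > 0")
        case True
        have "mean_deviation (Suc n) t \<le> 2 / (1 + t\<^sup>2)"
          unfolding mean_deviation_def
          by (intro measure_pmf.integral_le_const integrable_random_signed_graph always_eventually allI deviation_bound True) simp
        moreover have "0 \<le> mean_deviation (Suc n) t"
          unfolding mean_deviation_def by (rule integral_nonneg_AE) simp
        ultimately show ?thesis using True by simp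
      qed (use elim in simp)
    qed
  qed simp_all
  then show ?thesis by (subst (asm) filterlim_sequentially_Suc) simp
qed

text \<open>Both integral formulas are subtracted for each graph, pi / 2 * (8 / (3 pi)) being 4 / 3.
  The absolute value then moves under the integral, and the expectation, a finite sum, is exchanged
  with it.\<close>

lemma energy_deviation:
  assumes n: "n > 0"
  shows "measure_pmf.expectation (random_signed_graph n p q)
      (\<lambda>G. \<bar>n powr (-3/2) * energy (signed_adjacency n G) - 8 / (3 * pi) * sqrt sv\<bar>)
    \<le> 2 / pi * (\<integral>t. mean_deviation n t * indicator {0..} t \<partial>lborel)"
proof -
  let ?M = "random_signed_graph n p q"
  let ?d = "\<lambda>G t. \<bar>spectral_tail (signed_adjacency n G) t - sv * (semicircle_stieltjes sv t)\<^sup>2\<bar> * indicator {0..} t"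
  let ?e = "\<lambda>G. \<bar>n powr (-3/2) * energy (signed_adjacency n G) - 8 / (3 * pi) * sqrt sv\<bar>"
  have diff: "has_bochner_integral lborel (\<lambda>t. (spectral_tail (signed_adjacency n G) t - sv * (semicircle_stieltjes sv t)\<^sup>2) * indicator {0..} t)
    (pi / 2 * (n powr (-3/2) * energy (signed_adjacency n G) - 8 / (3 * pi) * sqrt sv))" for G
  proof -
    interpret symmetric_mat "signed_adjacency n G" n by (rule symmetric_mat_signed_adjacency)
    have "has_bochner_integral lborel (\<lambda>t. spectral_tail (signed_adjacency n G) t * indicator {0..} t
        - sv * (semicircle_stieltjes sv t)\<^sup>2 * indicator {0..} t)
      (pi / 2 * (n powr (-3/2) * energy (signed_adjacency n G)) - 4 / 3 * sqrt sv)"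
      by (intro has_bochner_integral_diff has_bochner_integral_spectral_tail n has_bochner_integral_semicircle variance_bounds)
    then show ?thesis by (simp add: algebra_simps)
  qed
  have int: "integrable lborel (?d G)" for G
    using integrable_abs[OF has_bochner_integral_iff[THEN iffD1, OF diff, THEN conjunct1], of G]
    by (simp add: abs_mult)
  have e: "pi / 2 * ?e G \<le> (\<integral>t. ?d G t \<partial>lborel)" for G
  proof -
    have "pi / 2 * ?e G = \<bar>\<integral>t. (spectral_tail (signed_adjacency n G) t - sv * (semicircle_stieltjes sv t)\<^sup>2) * indicator {0..} t \<partial>lborel\<bar>"
      unfolding has_bochner_integral_integral_eq[OF diff] abs_mult[of "pi / 2"] by simp
    also have "\<dots> \<le> (\<integral>t. \<bar>(spectral_tail (signed_adjacency n G) t - sv * (semicircle_stieltjes sv t)\<^sup>2) * indicator {0..} t\<bar> \<partial>lborel)"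
      by (rule integral_abs_bound)
    finally show ?thesis by (simp add: abs_mult)
  qed
  have fin: "measure_pmf.expectation ?M f = (\<Sum>G\<in>set_pmf ?M. f G * pmf ?M G)" for f :: "signed_graph \<Rightarrow> real"
    by (intro integral_measure_pmf_real finite_set_random_signed_graph) auto
  have "pi / 2 * measure_pmf.expectation ?M ?e = measure_pmf.expectation ?M (\<lambda>G. pi / 2 * ?e G)"
    by simp
  also have "\<dots> \<le> measure_pmf.expectation ?M (\<lambda>G. \<integral>t. ?d G t \<partial>lborel)"
    by (intro integral_mono integrable_random_signed_graph e)
  also have "\<dots> = (\<Sum>G\<in>set_pmf ?M. \<integral>t. ?d G t * pmf ?M G \<partial>lborel)"
    unfolding fin by simp
  also have "\<dots> = (\<integral>t. (\<Sum>G\<in>set_pmf ?M. ?d G t * pmf ?M G) \<partial>lborel)"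
    by (rule Bochner_Integration.integral_sum[symmetric]) (intro integrable_mult_left int)
  also have "\<dots> = (\<integral>t. mean_deviation n t * indicator {0..} t \<partial>lborel)"
    unfolding mean_deviation_def fin sum_distrib_right by (simp only: mult_ac)
  finally show ?thesis by (simp add: field_simps)
qed

end

theorem theorem2p7:
  fixes p q :: real
  assumes "p \<ge> 0" and "q \<ge> 0" and "p + q \<le> 1"
  shows "\<forall>\<epsilon>>0. (\<lambda>n. measure_pmf.prob (random_signed_graph n p q)
           {G. \<bar>real n powr (-3/2) * energy (signed_adjacency n G)
                 - 8 / (3 * pi) * sqrt (p + q - (p - q)\<^sup>2)\<bar> < \<epsilon>}) \<longlonglongrightarrow> 1"
proof (intro allI impI)
  fix \<epsilon> :: real assume \<epsilon>: "\<epsilon> > 0"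
  let ?e = "\<lambda>n G. \<bar>real n powr (-3/2) * energy (signed_adjacency n G) - 8 / (3 * pi) * sqrt (p + q - (p - q)\<^sup>2)\<bar>"
  let ?I = "\<lambda>n. \<integral>t. mean_deviation p q n t * indicator {0..} t \<partial>lborel"
  show "(\<lambda>n. measure_pmf.prob (random_signed_graph n p q) {G. ?e n G < \<epsilon>}) \<longlonglongrightarrow> 1"
  proof (rule real_tendsto_sandwich)
    show "eventually (\<lambda>n. measure_pmf.prob (random_signed_graph n p q) {G. ?e n G < \<epsilon>} \<le> 1) sequentially"
      by simp
    \<comment> \<open>Convergence in mean becomes convergence in probability by Markov's inequality
      for the complementary event.\<close>
    show "eventually (\<lambda>n. 1 - 2 / pi * ?I n / \<epsilon> \<le> measure_pmf.prob (random_signed_graph n p q) {G. ?e n G < \<epsilon>}) sequentially"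
      using eventually_gt_at_top[of 0]
    proof eventually_elim
      case (elim n)
      let ?M = "measure_pmf (random_signed_graph n p q)"
      have "measure ?M {G \<in> space ?M. ?e n G \<ge> \<epsilon>} \<le> measure_pmf.expectation (random_signed_graph n p q) (?e n) / \<epsilon>"
        by (rule integral_Markov_inequality_measure[where A = "{}"]) (use \<epsilon> in auto)
      also have "\<dots> \<le> 2 / pi * ?I n / \<epsilon>"
        using energy_deviation[OF assms elim] \<epsilon> by (intro divide_right_mono) auto
      finally have "measure ?M {G. ?e n G \<ge> \<epsilon>} \<le> 2 / pi * ?I n / \<epsilon>" by simp
      moreover have "measure ?M {G. ?e n G < \<epsilon>} = 1 - measure ?M {G. ?e n G \<ge> \<epsilon>}"
      proof -
        have "{G. ?e n G < \<epsilon>} = space ?M - {G. ?e n G \<ge> \<epsilon>}" by auto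
        then show ?thesis by (simp only: measure_pmf.prob_compl sets_measure_pmf UNIV_I Pow_UNIV)
      qed
      ultimately show ?case by simp
    qed
    have "(\<lambda>n. 1 - 2 / pi * ?I n / \<epsilon>) \<longlonglongrightarrow> 1 - 2 / pi * 0 / \<epsilon>"
      by (intro tendsto_intros integral_mean_deviation_tendsto_0 assms) (use \<epsilon> in simp)
    then show "(\<lambda>n. 1 - 2 / pi * ?I n / \<epsilon>) \<longlonglongrightarrow> 1" by simp
  qed simp
qed

end
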